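(* There exists a weakly complete improper affine front $f\colon\mathbb{D}_1\to\mathbb{R}^3$, defined on the unit disk $\mathbb{D}_1=\{z\in\mathbb{C}:|z|<1\}$, whose image is bounded and such that $\mathbb{D}_1\setminus\Sigma_f$ is open and dense in $\mathbb{D}_1$, where $\Sigma_f$ is the set of singular points of $f$.
   Context: Identify $\mathbb{R}^3=\mathbb{C}\times\mathbb{R}$. An improper affine front (IA-map) $f\colon\mathbb{D}_1\to\mathbb{R}^3$ is an improper affine sphere with certain admissible singularities; on $\mathbb{D}_1$ it is given by Martínez' representation formula $$f=\left(G+\overline F,\ \tfrac12\bigl(|G|^2-|F|^2\bigr)+\operatorname{Re}\Bigl(GF-2\int F\,dG\Bigr)\right),$$ where $F,G$ are holomorphic functions on $\mathbb{D}_1$ such that the metric $d\tau^2:=|dF|^2+|dG|^2$ is positive definite. The improper affine front $f$ is called weakly complete if $d\tau^2$ is a complete Riemannian metric on $\mathbb{D}_1$. The singular set of $f$ is $\Sigma_f=\{z\in\mathbb{D}_1: |\rho(z)|=1\}$, where $\rho=dG/dF$. *)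

theory Defs
  imports "HOL-Complex_Analysis.Complex_Analysis"
begin

abbreviation unit_disk :: "complex set" where
  "unit_disk \<equiv> ball 0 1"

text \<open>The metric \<open>d\<tau>\<^sup>2 = |dF|\<^sup>2 + |dG|\<^sup>2\<close> at the point \<open>z\<close>, evaluated as a quadratic form on the
  tangent vector \<open>v\<close>.\<close>

definition dtau2 :: "(complex \<Rightarrow> complex) \<Rightarrow> (complex \<Rightarrow> complex) \<Rightarrow> complex \<Rightarrow> complex \<Rightarrow> real" where
  "dtau2 F G z v = (cmod (deriv F z * v))\<^sup>2 + (cmod (deriv G z * v))\<^sup>2"

definition dtau2_pos_def :: "(complex \<Rightarrow> complex) \<Rightarrow> (complex \<Rightarrow> complex) \<Rightarrow> bool" where
  "dtau2_pos_def F G \<longleftrightarrow> (\<forall>z\<in>unit_disk. \<forall>v. v \<noteq> 0 \<longrightarrow> dtau2 F G z v > 0)"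

text \<open>\<open>f\<close> is an improper affine front on the disk with Martinez data \<open>(F, G)\<close>, where
  \<open>\<real>\<^sup>3 = \<complex> \<times> \<real>\<close>. The integral of \<open>F dG\<close> is an arbitrary primitive \<open>H\<close>; its constant of
  integration is a vertical translation of \<open>f\<close>.\<close>

definition improper_affine_front ::
  "(complex \<Rightarrow> complex) \<Rightarrow> (complex \<Rightarrow> complex) \<Rightarrow> (complex \<Rightarrow> complex \<times> real) \<Rightarrow> bool" where
  "improper_affine_front F G f \<longleftrightarrow>
     F holomorphic_on unit_disk \<and> G holomorphic_on unit_disk \<and> dtau2_pos_def F G \<and>
     (\<exists>H. (\<forall>z\<in>unit_disk. (H has_field_derivative F z * deriv G z) (at z)) \<and>
          (\<forall>z\<in>unit_disk. f z =
             (G z + cnj (F z),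
              ((cmod (G z))\<^sup>2 - (cmod (F z))\<^sup>2) / 2 + Re (G z * F z - 2 * H z))))"

text \<open>Lengths take values in \<^typ>\<open>ennreal\<close>, since \<^const>\<open>valid_path\<close> allows the speed to be
  unbounded near the break points: non-rectifiable paths get length \<open>\<infinity>\<close>.\<close>

definition dtau_length ::
  "(complex \<Rightarrow> complex) \<Rightarrow> (complex \<Rightarrow> complex) \<Rightarrow> (real \<Rightarrow> complex) \<Rightarrow> ennreal" where
  "dtau_length F G \<gamma> =
     (\<integral>\<^sup>+t\<in>{0..1}. ennreal (sqrt (dtau2 F G (\<gamma> t) (vector_derivative \<gamma> (at t within {0..1})))) \<partial>lborel)"

text \<open>The infimum is finite for points of the disk, so \<^const>\<open>enn2real\<close> loses nothing there.\<close>

definition dtau_dist ::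
  "(complex \<Rightarrow> complex) \<Rightarrow> (complex \<Rightarrow> complex) \<Rightarrow> complex \<Rightarrow> complex \<Rightarrow> real" where
  "dtau_dist F G p q = enn2real
     (INF \<gamma>\<in>{\<gamma>. valid_path \<gamma> \<and> path_image \<gamma> \<subseteq> unit_disk \<and> pathstart \<gamma> = p \<and> pathfinish \<gamma> = q}.
        dtau_length F G \<gamma>)"

definition weakly_complete :: "(complex \<Rightarrow> complex) \<Rightarrow> (complex \<Rightarrow> complex) \<Rightarrow> bool" where
  "weakly_complete F G \<longleftrightarrow> Metric_space.mcomplete unit_disk (dtau_dist F G)"

text \<open>At zeros of \<open>F'\<close> the meromorphic function \<open>\<rho> = dG/dF\<close> is \<open>\<infinity>\<close> (\<open>F'\<close> and \<open>G'\<close> have no common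
  zeros for a front), so such points are not singular; the convention \<open>x / 0 = 0\<close> also
  excludes them from the set below.\<close>

definition rho :: "(complex \<Rightarrow> complex) \<Rightarrow> (complex \<Rightarrow> complex) \<Rightarrow> complex \<Rightarrow> complex" where
  "rho F G z = deriv G z / deriv F z"

text \<open>The singular set depends only on the front \<open>f\<close>: its horizontal part \<open>G + cnj F\<close> determines
  \<open>F'\<close> and \<open>G'\<close>.\<close>

definition singular_set :: "(complex \<Rightarrow> complex) \<Rightarrow> (complex \<Rightarrow> complex) \<Rightarrow> complex set" where
  "singular_set F G = {z \<in> unit_disk. cmod (rho F G z) = 1}"

end

theory Submission
  imports Defs
begin

text \<open>Write \<open>K\<close> for a primitive of \<open>(F G' - G F') / 2\<close>; if \<open>F\<close>, \<open>G\<close>, \<open>K\<close> are bounded, then so is the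
  front. They are limits of polynomials, corrected in the manner of Rudin and Shapiro: with \<open>\<zeta> = z\<^sup>N\<close>,
  replace \<open>(F, G)\<close> by \<open>(F + \<epsilon> \<zeta> A, G + \<epsilon> \<zeta> B)\<close>. This moves \<open>K\<close> by \<open>\<epsilon> \<zeta> (F B - G A) / 2 + O(1/N)\<close>. On the
  unit circle \<open>A\<close>, \<open>B\<close> are trigonometric polynomials in \<open>F\<close>, \<open>G\<close>, \<open>K\<close> and their conjugates, chosen such that
  the gauge \<open>(|F|\<^sup>2 + |G|\<^sup>2 - 3)\<^sup>2 + |K|\<^sup>2\<close> changes only by \<open>O(\<epsilon>\<^sup>2 + 1/N)\<close>. The constant \<open>3\<close> keeps
  \<open>(F, G)\<close> away from \<open>0\<close> on the circle, where all such \<open>(A, B)\<close> would vanish. Since \<open>|(F', G')|\<close> is of size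
  \<open>\<epsilon> N\<close> on an annulus of width \<open>1 / (4 N)\<close> near the circle, crossing it costs a length of order \<open>\<epsilon>\<close>.
  With \<open>\<epsilon>\<^sub>n\<close> of order \<open>1/n\<close> the gauge stays bounded and the lengths add up to infinity. Finally, adding
  linear terms to \<open>F\<close> and \<open>G\<close> removes the common zeros of \<open>F'\<close> and \<open>G'\<close> and makes \<open>|F'| \<noteq> |G'|\<close>
  at the origin, hence on a dense set.\<close>

section \<open>The gauge and its second-order variation\<close>

text \<open>The obstacle is \<open>K\<close>: bounds on \<open>F\<close> and \<open>G\<close> do not
  control it, so two free functions must keep three bounded. Integrating against
  \<open>\<zeta>\<close> gains a factor 1/N, hence up to O(1/N) \<open>K\<close> reacts pointwise to
  the correction, and boundedness becomes a pointwise question in C^3. There, stationarity of one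
  real gauge for every phase of \<open>\<zeta>\<close> is a single complex linear equation in the
  two unknowns \<open>A\<close>, \<open>B\<close>, so it has a nonzero solution. What remains is of
  order \<open>\<epsilon>\<close> squared, and 1/n is square summable without being summable: this
  is the room in which the lengths diverge. The chosen solution degenerates in a second place, where
  the gauge is 0. The gauge is therefore kept in [1/2, 3/2], starting from the value 1: the lower
  end excludes |F|^2 + |G|^2 = 3 with K = 0, the upper end excludes F = G = 0, where the gauge is at
  least 9. The gauge obeys no maximum principle, so it is followed on the unit circle only, and the
  resulting bounds on the three polynomials are carried inside one by one.\<close>

definition gauge :: "complex \<Rightarrow> complex \<Rightarrow> complex \<Rightarrow> real" where
  "gauge x y k = ((cmod x)\<^sup>2 + (cmod y)\<^sup>2 - 3)\<^sup>2 + (cmod k)\<^sup>2"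

text \<open>Up to scaling, \<open>(dir1, dir2)\<close> is the solution \<open>(A, B)\<close> of the complex linear equation expressing that the
  gauge is stationary when \<open>(x, y, k)\<close> moves in the direction \<open>(\<zeta> A, \<zeta> B, \<zeta> (x B - y A) / 2)\<close>, for all \<open>\<zeta>\<close>.\<close>

definition dir1 :: "complex \<Rightarrow> complex \<Rightarrow> complex \<Rightarrow> complex" where
  "dir1 x y k = - (4 * of_real ((cmod x)\<^sup>2 + (cmod y)\<^sup>2 - 3) * cnj y + cnj k * x)"

definition dir2 :: "complex \<Rightarrow> complex \<Rightarrow> complex \<Rightarrow> complex" where
  "dir2 x y k = 4 * of_real ((cmod x)\<^sup>2 + (cmod y)\<^sup>2 - 3) * cnj x - cnj k * y"

lemma cmod_add_square:
  "(cmod (z + w))\<^sup>2 = (cmod z)\<^sup>2 + 2 * Re (cnj z * w) + (cmod w)\<^sup>2"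
  unfolding cmod_power2 by (simp add: power2_eq_square algebra_simps)

text \<open>The vectors (x, y) and (cnj y, - cnj x) are Hermitian-orthogonal and of equal norm, and
  \<open>(dir1, dir2)\<close> combines them with coefficients of modulus |k| and 4 |a|, where a =
  |x|^2 + |y|^2 - 3. Pythagoras shows that the direction vanishes only if x = y = 0 or a = k =
  0.\<close>

lemma dir_norm:
  "(cmod (dir1 x y k))\<^sup>2 + (cmod (dir2 x y k))\<^sup>2 =
     ((cmod x)\<^sup>2 + (cmod y)\<^sup>2) * (16 * ((cmod x)\<^sup>2 + (cmod y)\<^sup>2 - 3)\<^sup>2 + (cmod k)\<^sup>2)"
proof -
  define a where "a = (cmod x)\<^sup>2 + (cmod y)\<^sup>2 - 3"
  have "(cmod (- (4 * of_real a * cnj y + cnj k * x)))\<^sup>2 + (cmod (4 * of_real a * cnj x - cnj k * y))\<^sup>2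
     = ((cmod x)\<^sup>2 + (cmod y)\<^sup>2) * (16 * a\<^sup>2 + (cmod k)\<^sup>2)"
    unfolding cmod_power2 by (simp add: power2_eq_square algebra_simps)
  then show ?thesis by (simp add: dir1_def dir2_def a_def)
qed

lemma gauge_bounds:
  assumes "gauge x y k \<le> 3/2"
  shows "\<bar>(cmod x)\<^sup>2 + (cmod y)\<^sup>2 - 3\<bar> \<le> 5/4" and "cmod k \<le> 5/4"
proof -
  have "\<bar>(cmod x)\<^sup>2 + (cmod y)\<^sup>2 - 3\<bar>\<^sup>2 \<le> gauge x y k" "(cmod k)\<^sup>2 \<le> gauge x y k"
    by (simp_all add: gauge_def)
  moreover have "gauge x y k \<le> (5/4)\<^sup>2" using assms by (simp add: power_divide)
  ultimately have "\<bar>(cmod x)\<^sup>2 + (cmod y)\<^sup>2 - 3\<bar>\<^sup>2 \<le> (5/4)\<^sup>2" "(cmod k)\<^sup>2 \<le> (5/4)\<^sup>2"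
    by linarith+
  note sq = this
  show "\<bar>(cmod x)\<^sup>2 + (cmod y)\<^sup>2 - 3\<bar> \<le> 5/4" using sq(1) by (rule power2_le_imp_le) simp
  show "cmod k \<le> 5/4" using sq(2) by (rule power2_le_imp_le) simp
qed

lemma dir_norm_ge:
  assumes "1/2 \<le> gauge x y k" and "gauge x y k \<le> 3/2"
  shows "1/2 \<le> (cmod (dir1 x y k))\<^sup>2 + (cmod (dir2 x y k))\<^sup>2"
proof -
  have "gauge x y k \<le> 16 * ((cmod x)\<^sup>2 + (cmod y)\<^sup>2 - 3)\<^sup>2 + (cmod k)\<^sup>2" by (simp add: gauge_def)
  \<comment> \<open>The first factor is at least 3 - 5/4, hence above 1; the second is at least the
    gauge.\<close>
  then have "1 * (1/2) \<le> ((cmod x)\<^sup>2 + (cmod y)\<^sup>2) * (16 * ((cmod x)\<^sup>2 + (cmod y)\<^sup>2 - 3)\<^sup>2 + (cmod k)\<^sup>2)"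
    using gauge_bounds(1)[OF assms(2)] assms(1) by (intro mult_mono) linarith+
  then show ?thesis by (simp add: dir_norm)
qed

text \<open>The first-order term cancels by the choice of direction, which leaves
  \<open>\<epsilon>\<close> squared. The error \<open>e\<close>, which will be the O(1/N) remainder
  in \<open>K\<close>, is not cancelled and enters linearly. Both constants are crude; what matters
  is that they depend on the bound 3/2 alone.\<close>

lemma gauge_step:
  fixes x y k \<zeta> e :: complex and \<epsilon> :: real
  assumes g: "gauge x y k \<le> 3/2" and z: "cmod \<zeta> = 1" and eps: "0 \<le> \<epsilon>" "\<epsilon> \<le> 1" and e: "cmod e \<le> \<eta>" "\<eta> \<le> 1"
    and u: "u = \<zeta> * dir1 x y k" and v: "v = \<zeta> * dir2 x y k"
  shows "\<bar>gauge (x + of_real \<epsilon> * u) (y + of_real \<epsilon> * v) (k + of_real \<epsilon> * ((x * v - y * u) / 2) + e)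
            - gauge x y k\<bar> \<le> 50000 * \<epsilon>\<^sup>2 + 200 * \<eta>"
proof -
  define a where "a = (cmod x)\<^sup>2 + (cmod y)\<^sup>2 - 3"
  define \<kappa> where "\<kappa> = (x * v - y * u) / 2"
  define \<rho> where "\<rho> = Re (cnj x * u) + Re (cnj y * v)"
  define \<beta> where "\<beta> = (cmod u)\<^sup>2 + (cmod v)\<^sup>2"
  define t where "t = 2 * Re (cnj (k + of_real \<epsilon> * \<kappa>) * e) + (cmod e)\<^sup>2"
  have ab: "\<bar>a\<bar> \<le> 5/4" and kb: "cmod k \<le> 5/4" using gauge_bounds[OF g] by (auto simp: a_def)
  have R: "(cmod x)\<^sup>2 + (cmod y)\<^sup>2 = a + 3" by (simp add: a_def)
  have \<beta>: "\<beta> = (a + 3) * (16 * a\<^sup>2 + (cmod k)\<^sup>2)"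
    using dir_norm[of x y k] by (simp add: \<beta>_def u v norm_mult z R)
  have sq: "a\<^sup>2 + (cmod k)\<^sup>2 \<le> 3/2" using g by (simp add: gauge_def a_def)
  \<comment> \<open>Here 17/4 = 3 + 5/4 and 24 = 16 * 3/2.\<close>
  have "\<beta> \<le> (17/4) * 24" unfolding \<beta>
    using ab sq by (intro mult_mono) (auto simp: abs_le_iff intro: order_trans[of _ "16 * (a\<^sup>2 + (cmod k)\<^sup>2)"])
  then have \<beta>b: "0 \<le> \<beta>" "\<beta> \<le> 102" by (auto simp: \<beta>_def)
  \<comment> \<open>The sum of the four squared norms is at most 17/4 + 102 < 107, and 54 exceeds
    half of 107.\<close>
  have young: "p * q + r * s \<le> 54" if "p\<^sup>2 + q\<^sup>2 + r\<^sup>2 + s\<^sup>2 \<le> 107" for p q r s :: real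
    using that zero_le_power2[of "p - q"] zero_le_power2[of "r - s"] by (simp add: power2_eq_square algebra_simps)
  have "(cmod x)\<^sup>2 + (cmod u)\<^sup>2 + (cmod y)\<^sup>2 + (cmod v)\<^sup>2 \<le> 107" "(cmod x)\<^sup>2 + (cmod v)\<^sup>2 + (cmod y)\<^sup>2 + (cmod u)\<^sup>2 \<le> 107"
    using R ab \<beta>b by (auto simp: \<beta>_def)
  note y1 = young[OF this(1)] and y2 = young[OF this(2)]
  have \<rho>b: "\<bar>\<rho>\<bar> \<le> 54"
    using y1 abs_Re_le_cmod[of "cnj x * u"] abs_Re_le_cmod[of "cnj y * v"]
    unfolding \<rho>_def norm_mult complex_mod_cnj by linarith
  have \<kappa>b: "cmod \<kappa> \<le> 27"
    using y2 norm_triangle_ineq4[of "x * v" "y * u"] by (simp add: \<kappa>_def norm_divide norm_mult)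
  have canc: "4 * a * \<rho> + 2 * Re (cnj k * \<kappa>) = 0"
  proof -
    have "2 * Re (cnj k * \<kappa>) = Re (cnj k * (2 * \<kappa>))" by simp
    also have "2 * \<kappa> = x * v - y * u" by (simp add: \<kappa>_def)
    finally have "4 * a * \<rho> + 2 * Re (cnj k * \<kappa>) =
        Re ((4 * of_real a * cnj x - cnj k * y) * u + (4 * of_real a * cnj y + cnj k * x) * v)"
      by (simp add: \<rho>_def algebra_simps)
    \<comment> \<open>The coefficients of \<open>u\<close> and \<open>v\<close> in the differential
      of the gauge are \<open>dir2\<close> and \<open>- dir1\<close> themselves, so
      \<open>u\<close>, \<open>v\<close> proportional to \<open>dir1\<close>, \<open>dir2\<close>
      annihilate it.\<close>
    also have "\<dots> = Re (dir2 x y k * u - dir1 x y k * v)"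
      unfolding dir1_def dir2_def a_def by (simp only: mult_minus_left diff_minus_eq_add)
    also have "\<dots> = 0" by (simp add: u v)
    finally show ?thesis .
  qed
  have h1: "(cmod (x + of_real \<epsilon> * u))\<^sup>2 + (cmod (y + of_real \<epsilon> * v))\<^sup>2 - 3 = a + (2 * \<epsilon> * \<rho> + \<epsilon>\<^sup>2 * \<beta>)"
    unfolding cmod_add_square by (simp add: a_def \<rho>_def \<beta>_def norm_mult power_mult_distrib algebra_simps)
  have h2: "(cmod (k + of_real \<epsilon> * \<kappa> + e))\<^sup>2 = (cmod k)\<^sup>2 + 2 * \<epsilon> * Re (cnj k * \<kappa>) + \<epsilon>\<^sup>2 * (cmod \<kappa>)\<^sup>2 + t"
    unfolding cmod_add_square[of "k + of_real \<epsilon> * \<kappa>" e] cmod_add_square[of k] t_def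
    by (simp add: norm_mult power_mult_distrib algebra_simps)
  have "gauge (x + of_real \<epsilon> * u) (y + of_real \<epsilon> * v) (k + of_real \<epsilon> * \<kappa> + e) - gauge x y k
      = \<epsilon> * (4 * a * \<rho> + 2 * Re (cnj k * \<kappa>)) + ((2 * \<epsilon> * \<rho> + \<epsilon>\<^sup>2 * \<beta>)\<^sup>2 + 2 * a * \<epsilon>\<^sup>2 * \<beta> + \<epsilon>\<^sup>2 * (cmod \<kappa>)\<^sup>2 + t)"
    unfolding gauge_def h1 h2 a_def[symmetric] by (simp add: power2_eq_square algebra_simps)
  then have eq: "gauge (x + of_real \<epsilon> * u) (y + of_real \<epsilon> * v) (k + of_real \<epsilon> * \<kappa> + e) - gauge x y k
      = \<epsilon>\<^sup>2 * ((2 * \<rho> + \<epsilon> * \<beta>)\<^sup>2 + 2 * a * \<beta> + (cmod \<kappa>)\<^sup>2) + t"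
    unfolding canc by (simp add: power2_eq_square algebra_simps)
  have "0 \<le> \<epsilon> * \<beta>" using eps \<beta>b by simp
  moreover have "\<epsilon> * \<beta> \<le> 1 * 102" using eps \<beta>b by (intro mult_mono) auto
  ultimately have "\<bar>2 * \<rho> + \<epsilon> * \<beta>\<bar> \<le> 210" using \<rho>b by linarith
  then have "\<bar>2 * \<rho> + \<epsilon> * \<beta>\<bar>\<^sup>2 \<le> 210\<^sup>2" by (intro power_mono) auto
  moreover have "\<bar>2 * a * \<beta>\<bar> \<le> 2 * (5/4) * 102"
    unfolding abs_mult using ab \<beta>b by (intro mult_mono) auto
  moreover have "(cmod \<kappa>)\<^sup>2 \<le> 27\<^sup>2" using \<kappa>b by (intro power_mono) auto
  \<comment> \<open>The three bounds add up to 44100 + 255 + 729.\<close>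
  moreover have "\<bar>p + q + s\<bar> \<le> 50000" if "p \<le> 210\<^sup>2" "\<bar>q\<bar> \<le> 2 * (5/4) * 102" "s \<le> 27\<^sup>2" "0 \<le> p" "0 \<le> s"
    for p q s :: real
    using that by (simp add: abs_le_iff)
  ultimately have "\<bar>(2 * \<rho> + \<epsilon> * \<beta>)\<^sup>2 + 2 * a * \<beta> + (cmod \<kappa>)\<^sup>2\<bar> \<le> 50000"
    unfolding power2_abs by simp
  then have q: "\<bar>\<epsilon>\<^sup>2 * ((2 * \<rho> + \<epsilon> * \<beta>)\<^sup>2 + 2 * a * \<beta> + (cmod \<kappa>)\<^sup>2)\<bar> \<le> \<epsilon>\<^sup>2 * 50000"
    by (simp add: abs_mult mult_left_mono)
  have "\<epsilon> * cmod \<kappa> \<le> 1 * 27" using eps \<kappa>b by (intro mult_mono) auto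
  then have "cmod (k + of_real \<epsilon> * \<kappa>) \<le> 30"
    using norm_triangle_ineq[of k "of_real \<epsilon> * \<kappa>"] kb eps by (simp add: norm_mult)
  then have "cmod (k + of_real \<epsilon> * \<kappa>) * cmod e \<le> 30 * \<eta>" using e by (intro mult_mono) auto
  then have "\<bar>Re (cnj (k + of_real \<epsilon> * \<kappa>) * e)\<bar> \<le> 30 * \<eta>"
    using abs_Re_le_cmod[of "cnj (k + of_real \<epsilon> * \<kappa>) * e"] unfolding norm_mult complex_mod_cnj by linarith
  moreover have "(cmod e)\<^sup>2 \<le> \<eta> * 1" unfolding power2_eq_square using e by (intro mult_mono) (auto intro: order_trans[OF norm_ge_zero])
  ultimately have "\<bar>t\<bar> \<le> 200 * \<eta>" unfolding t_def using e norm_ge_zero[of e] zero_le_power2[of "cmod e"] by linarith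
  then show ?thesis using q unfolding \<kappa>_def[symmetric] eq by linarith
qed

section \<open>The inductive step\<close>

lemma poly_reflection:
  fixes p :: "complex poly"
  shows "\<exists>d0. \<forall>d\<ge>d0. \<exists>q. \<forall>z. cmod z = 1 \<longrightarrow> poly q z = z ^ d * cnj (poly p z)"
proof (induction p)
  case 0
  show ?case by (auto intro!: exI[of _ 0])
next
  case (pCons a p)
  then obtain d0 where d0: "\<And>d. d \<ge> d0 \<Longrightarrow> \<exists>q. \<forall>z. cmod z = 1 \<longrightarrow> poly q z = z ^ d * cnj (poly p z)" by blast
  show ?case
  proof (intro exI[of _ "Suc d0"] allI impI)
    fix d assume "d \<ge> Suc d0"
    then obtain d' where d': "d = Suc d'" "d' \<ge> d0" by (cases d) auto
    from d0[OF d'(2)] obtain q where q: "\<And>z. cmod z = 1 \<Longrightarrow> poly q z = z ^ d' * cnj (poly p z)" by blast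
    have "poly (monom (cnj a) d + q) z = z ^ d * cnj (poly (pCons a p) z)" if z: "cmod z = 1" for z
    proof -
      have "z * cnj z = 1" using z by (simp add: complex_norm_square[symmetric])
      then have "z ^ d * cnj z = z ^ d'" by (simp add: d' mult.commute mult.left_commute)
      then show ?thesis using q[OF z]
        by (simp add: poly_monom algebra_simps)
    qed
    then show "\<exists>q. \<forall>z. cmod z = 1 \<longrightarrow> poly q z = z ^ d * cnj (poly (pCons a p) z)" by blast
  qed
qed

text \<open>Every monomial of \<open>monom 1 n * p\<close> has degree at least n, so integration
  divides it by at least n + 1. The constant, a sum of moduli of coefficients, depends on
  \<open>p\<close> alone, so n can be chosen after it.\<close>

lemma poly_antiderivative_small:
  fixes p :: "complex poly"
  shows "\<exists>C\<ge>0. \<forall>n. \<exists>q. pderiv q = monom 1 n * p \<and> (\<forall>z. cmod z \<le> 1 \<longrightarrow> cmod (poly q z) \<le> C / real (Suc n))"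
proof (induction p)
  case 0
  show ?case by (auto intro!: exI[of _ 0])
next
  case (pCons a p)
  then obtain C where C: "C \<ge> 0" "\<And>n. \<exists>q. pderiv q = monom 1 n * p \<and> (\<forall>z. cmod z \<le> 1 \<longrightarrow> cmod (poly q z) \<le> C / real (Suc n))" by blast
  have "\<exists>q. pderiv q = monom 1 n * pCons a p \<and> (\<forall>z. cmod z \<le> 1 \<longrightarrow> cmod (poly q z) \<le> (cmod a + C) / real (Suc n))" for n
  proof -
    obtain q where q: "pderiv q = monom 1 (Suc n) * p" "\<And>z. cmod z \<le> 1 \<Longrightarrow> cmod (poly q z) \<le> C / real (Suc (Suc n))"
      using C(2)[of "Suc n"] by blast
    let ?q = "monom (a / of_nat (Suc n)) (Suc n) + q"
    \<comment> \<open>Peeling off the constant coefficient raises the exponent of the remaining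
      factor by one, which is why the induction quantifies over all n.\<close>
    have "pCons a p = [:a:] + monom 1 1 * p" by (simp add: monom_altdef)
    then have "monom 1 n * pCons a p = monom a n + monom 1 (Suc n) * p"
      by (simp only: distrib_left mult.assoc[symmetric] mult_monom) (simp add: smult_monom mult.commute[of _ "[:a:]"])
    then have 1: "pderiv ?q = monom 1 n * pCons a p"
      by (simp add: pderiv_add pderiv_monom q(1) del: of_nat_Suc)
    have "cmod (poly ?q z) \<le> (cmod a + C) / real (Suc n)" if z: "cmod z \<le> 1" for z
    proof -
      have "cmod (poly ?q z) \<le> cmod (a / of_nat (Suc n) * z ^ Suc n) + cmod (poly q z)"
        by (simp only: poly_add poly_monom) (rule norm_triangle_ineq)
      also have "cmod (a / of_nat (Suc n) * z ^ Suc n) \<le> cmod a / real (Suc n) * 1"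
        unfolding norm_mult norm_divide norm_power norm_of_nat by (intro mult_left_mono power_le_one z) auto
      also have "cmod (poly q z) \<le> C / real (Suc n)"
        using q(2)[OF z] C(1) by (rule_tac order_trans[OF _ divide_left_mono[of "real (Suc n)" "real (Suc (Suc n))" C]]) auto
      finally show ?thesis by (simp add: add_divide_distrib)
    qed
    with 1 show ?thesis by blast
  qed
  then show ?case using C(1) by (intro exI[of _ "cmod a + C"]) auto
qed

lemma poly_bounded_on_disk:
  fixes p :: "complex poly"
  shows "\<exists>C>0. \<forall>z. cmod z \<le> 1 \<longrightarrow> cmod (poly p z) \<le> C"
proof -
  have "compact (poly p ` cball 0 1)" by (intro compact_continuous_image continuous_intros compact_cball)
  then obtain C where "C > 0" "\<forall>x\<in>poly p ` cball 0 1. norm x \<le> C" using compact_imp_bounded bounded_pos by metis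
  then show ?thesis by (intro exI[of _ C]) auto
qed

text \<open>Both r^k and k r^k tend to 0, so the factor k + 1 produced by differentiation is
  harmless inside. A correction that is violent near the circle is thus invisible on the earlier
  disks.\<close>

lemma monom_mult_small:
  fixes p :: "complex poly"
  assumes r: "0 \<le> r" "r < 1" and \<eta>: "\<eta> > 0"
  shows "\<forall>\<^sub>F k in sequentially. \<forall>z. cmod z \<le> r \<longrightarrow>
           cmod (poly (monom 1 (Suc k) * p) z) \<le> \<eta> \<and> cmod (poly (pderiv (monom 1 (Suc k) * p)) z) \<le> \<eta>"
proof -
  obtain C where C: "C > 0" "\<And>z. cmod z \<le> 1 \<Longrightarrow> cmod (poly p z) \<le> C" using poly_bounded_on_disk by blast
  obtain D where D: "D > 0" "\<And>z. cmod z \<le> 1 \<Longrightarrow> cmod (poly (pderiv p) z) \<le> D" using poly_bounded_on_disk by blast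
  have l1: "(\<lambda>k. r ^ k) \<longlonglongrightarrow> 0" using r by (intro LIMSEQ_realpow_zero) auto
  have l2: "(\<lambda>k. real k * r ^ k) \<longlonglongrightarrow> 0" using r powser_times_n_limit_0[of r] by simp
  have "(\<lambda>k. (real k * r ^ k + r ^ k) * C + r ^ k * D + r ^ k * C) \<longlonglongrightarrow> (0 + 0) * C + 0 * D + 0 * C"
    by (intro tendsto_intros l1 l2)
  then have "\<forall>\<^sub>F k in sequentially. (real k * r ^ k + r ^ k) * C + r ^ k * D + r ^ k * C < \<eta>"
    using \<eta> by (intro order_tendstoD) simp_all
  then show ?thesis
  proof eventually_elim
    case (elim k)
    show ?case
    proof (intro allI impI)
      fix z assume z: "cmod z \<le> r"
      have z1: "cmod z \<le> 1" using z r by simp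
      have zk: "cmod z ^ k \<le> r ^ k" "cmod z ^ Suc k \<le> r ^ k"
        using z z1 by (auto intro!: power_mono intro: order_trans[OF mult_left_le_one_le power_mono])
      have a: "cmod (z ^ Suc k * poly p z) \<le> r ^ k * C"
        unfolding norm_mult norm_power using C z1 zk r by (intro mult_mono) auto
      have b: "cmod (z ^ Suc k * poly (pderiv p) z) \<le> r ^ k * D"
        unfolding norm_mult norm_power using D z1 zk r by (intro mult_mono) auto
      have c: "cmod (of_nat (Suc k) * z ^ k * poly p z) \<le> (real k * r ^ k + r ^ k) * C"
        unfolding norm_mult norm_power norm_of_nat using C z1 zk r 
        by (intro mult_mono order_trans[OF mult_left_mono[OF zk(1)]]) (auto simp: algebra_simps)
      have "poly (pderiv (monom 1 (Suc k) * p)) z = of_nat (Suc k) * z ^ k * poly p z + z ^ Suc k * poly (pderiv p) z"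
        by (simp add: pderiv_mult pderiv_monom poly_monom algebra_simps)
      then have d: "cmod (poly (pderiv (monom 1 (Suc k) * p)) z) \<le> (real k * r ^ k + r ^ k) * C + r ^ k * D"
        using b c norm_triangle_ineq[of "of_nat (Suc k) * z ^ k * poly p z" "z ^ Suc k * poly (pderiv p) z"] by simp
      have "0 \<le> r ^ k * C" "0 \<le> (real k * r ^ k + r ^ k) * C" "0 \<le> r ^ k * D" using r C D by auto
      then show "cmod (poly (monom 1 (Suc k) * p) z) \<le> \<eta> \<and> cmod (poly (pderiv (monom 1 (Suc k) * p)) z) \<le> \<eta>"
        using a d elim by (simp add: poly_monom) 
    qed
  qed
qed

text \<open>The curve (F, G, K) in C^3 is Legendrian for the contact form dk - (x dy - y dx) /
  2.\<close>

definition contact_poly :: "complex poly \<Rightarrow> complex poly \<Rightarrow> complex poly \<Rightarrow> bool" where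
  "contact_poly F G K \<longleftrightarrow> pderiv K = smult (1/2) (F * pderiv G - G * pderiv F)"

lemma norm_Pair_mult: "norm (c * x, c * y) = cmod c * norm (x, y)" for c x y :: complex
  by (simp add: norm_Pair norm_mult power_mult_distrib real_sqrt_mult flip: distrib_left)

text \<open>\<open>pA\<close>, \<open>pB\<close> and \<open>C\<close> come before n and
  \<open>\<epsilon>\<close>, which leaves n free to beat \<open>C\<close> later. The error
  \<open>E\<close> is small because its derivative carries no factor n: at first order such terms
  are absorbed into the derivative of the explicit correction of \<open>K\<close>, at second order
  they cancel by antisymmetry.\<close>

lemma contact_perturbation:
  fixes F G K :: "complex poly"
  assumes K: "contact_poly F G K"
    and g: "\<And>z. cmod z = 1 \<Longrightarrow> gauge (poly F z) (poly G z) (poly K z) \<in> {1/2..3/2}"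
  obtains pA pB :: "complex poly" and C :: real where
    "\<And>z. cmod z = 1 \<Longrightarrow> 1/2 \<le> (cmod (poly pA z))\<^sup>2 + (cmod (poly pB z))\<^sup>2"
    "C > 0"
    "\<And>n \<epsilon>. 0 < \<epsilon> \<Longrightarrow> \<epsilon> \<le> 1 \<Longrightarrow>
       \<exists>E. contact_poly (F + smult (of_real \<epsilon>) (monom 1 n * pA)) (G + smult (of_real \<epsilon>) (monom 1 n * pB))
              (K + smult (of_real \<epsilon>) (monom 1 n * smult (1/2) (F * pB - G * pA)) + E) \<and>
          (\<forall>z. cmod z \<le> 1 \<longrightarrow> cmod (poly E z) \<le> C / Suc n) \<and>
          (C / Suc n \<le> 1 \<longrightarrow> (\<forall>z. cmod z = 1 \<longrightarrow>
             \<bar>gauge (poly (F + smult (of_real \<epsilon>) (monom 1 n * pA)) z) (poly (G + smult (of_real \<epsilon>) (monom 1 n * pB)) z)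
                (poly (K + smult (of_real \<epsilon>) (monom 1 n * smult (1/2) (F * pB - G * pA)) + E) z)
              - gauge (poly F z) (poly G z) (poly K z)\<bar> \<le> 50000 * \<epsilon>\<^sup>2 + 200 * (C / Suc n)))"
proof -
  obtain d1 where d1: "\<And>d. d \<ge> d1 \<Longrightarrow> \<exists>q. \<forall>z. cmod z = 1 \<longrightarrow> poly q z = z ^ d * cnj (poly F z)" using poly_reflection by blast
  obtain d2 where d2: "\<And>d. d \<ge> d2 \<Longrightarrow> \<exists>q. \<forall>z. cmod z = 1 \<longrightarrow> poly q z = z ^ d * cnj (poly G z)" using poly_reflection by blast
  obtain d3 where d3: "\<And>d. d \<ge> d3 \<Longrightarrow> \<exists>q. \<forall>z. cmod z = 1 \<longrightarrow> poly q z = z ^ d * cnj (poly K z)" using poly_reflection by blast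
  define d where "d = d1 + d2 + d3"
  obtain Fc where Fc: "\<And>z. cmod z = 1 \<Longrightarrow> poly Fc z = z ^ d * cnj (poly F z)" using d1[of d] by (auto simp: d_def)
  obtain Gc where Gc: "\<And>z. cmod z = 1 \<Longrightarrow> poly Gc z = z ^ d * cnj (poly G z)" using d2[of d] by (auto simp: d_def)
  obtain Kc where Kc: "\<And>z. cmod z = 1 \<Longrightarrow> poly Kc z = z ^ d * cnj (poly K z)" using d3[of d] by (auto simp: d_def)
  \<comment> \<open>The monomials equalise the powers of z: on the circle \<open>Al\<close> is z^d
    times the real factor |F|^2 + |G|^2 - 3, and \<open>pA\<close>, \<open>pB\<close> become z^(2d)
    times \<open>dir1\<close>, \<open>dir2\<close>.\<close>
  define Al where "Al = F * Fc + G * Gc - monom 3 d"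
  define pA where "pA = - (4 * Al * Gc + monom 1 d * Kc * F)"
  define pB where "pB = 4 * Al * Fc - monom 1 d * Kc * G"
  have Al: "poly Al z = z ^ d * of_real ((cmod (poly F z))\<^sup>2 + (cmod (poly G z))\<^sup>2 - 3)" if "cmod z = 1" for z
  proof -
    have sq: "(complex_of_real (cmod x))\<^sup>2 = x * cnj x" for x by (metis complex_norm_square of_real_power)
    show ?thesis using that by (simp add: Al_def Fc Gc poly_monom sq algebra_simps)
  qed
  have four: "poly 4 z = 4" for z :: complex using poly_of_nat[of 4 z] by simp
  have pA: "poly pA z = z ^ (d + d) * dir1 (poly F z) (poly G z) (poly K z)" if "cmod z = 1" for z
    unfolding pA_def dir1_def
    by (simp add: four Al Gc Kc that poly_monom power_add del: of_real_diff of_real_add) (simp add: algebra_simps)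
  have pB: "poly pB z = z ^ (d + d) * dir2 (poly F z) (poly G z) (poly K z)" if "cmod z = 1" for z
    unfolding pB_def dir2_def
    by (simp add: four Al Fc Kc that poly_monom power_add del: of_real_diff of_real_add) (simp add: algebra_simps)
  \<comment> \<open>The terms of the contact equation that must still be integrated:
    \<open>\<epsilon>\<close> times z^n \<open>p1\<close>, and half the square of
    \<open>\<epsilon>\<close> times z^(2n) \<open>p2\<close>.\<close>
  define p1 where "p1 = pA * pderiv G - pB * pderiv F"
  define p2 where "p2 = pA * pderiv pB - pB * pderiv pA"
  obtain C1 where C1: "C1 \<ge> 0" "\<And>n. \<exists>q. pderiv q = monom 1 n * p1 \<and> (\<forall>z. cmod z \<le> 1 \<longrightarrow> cmod (poly q z) \<le> C1 / real (Suc n))"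
    using poly_antiderivative_small by blast
  obtain C2 where C2: "C2 \<ge> 0" "\<And>n. \<exists>q. pderiv q = monom 1 n * p2 \<and> (\<forall>z. cmod z \<le> 1 \<longrightarrow> cmod (poly q z) \<le> C2 / real (Suc n))"
    using poly_antiderivative_small by blast
  define C where "C = C1 + C2 + 1"
  show ?thesis
  proof (rule that[of pA pB C])
    show "C > 0" using C1 C2 by (simp add: C_def)
    show "1/2 \<le> (cmod (poly pA z))\<^sup>2 + (cmod (poly pB z))\<^sup>2" if "cmod z = 1" for z
      using dir_norm_ge[of "poly F z" "poly G z" "poly K z"] g[OF that] by (simp add: pA pB that norm_mult norm_power)
    fix n :: nat and \<epsilon> :: real assume eps: "0 < \<epsilon>" "\<epsilon> \<le> 1"
    obtain P where P: "pderiv P = monom 1 n * p1" "\<And>z. cmod z \<le> 1 \<Longrightarrow> cmod (poly P z) \<le> C1 / real (Suc n)" using C1 by blast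
    obtain Q where Q: "pderiv Q = monom 1 (n + n) * p2" "\<And>z. cmod z \<le> 1 \<Longrightarrow> cmod (poly Q z) \<le> C2 / real (Suc (n + n))" using C2 by blast
    define E where "E = smult (of_real \<epsilon>) P + smult (of_real (\<epsilon>\<^sup>2 / 2)) Q"
    let ?F = "F + smult (of_real \<epsilon>) (monom 1 n * pA)"
    let ?G = "G + smult (of_real \<epsilon>) (monom 1 n * pB)"
    let ?K = "K + smult (of_real \<epsilon>) (monom 1 n * smult (1/2) (F * pB - G * pA)) + E"
    have Eb: "cmod (poly E z) \<le> C / Suc n" if z: "cmod z \<le> 1" for z
    proof -
      have "cmod (poly E z) \<le> \<epsilon> * cmod (poly P z) + (\<epsilon>\<^sup>2 / 2) * cmod (poly Q z)"
        using norm_triangle_ineq[of "of_real \<epsilon> * poly P z" "of_real (\<epsilon>\<^sup>2 / 2) * poly Q z"] eps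
        by (simp add: E_def norm_mult norm_divide norm_power)
      also have "\<dots> \<le> 1 * (C1 / Suc n) + 1 * (C2 / Suc n)"
      proof (intro add_mono mult_mono)
        show "cmod (poly P z) \<le> C1 / Suc n" using P(2)[OF z] .
        have "C2 / real (Suc (n + n)) \<le> C2 / real (Suc n)" using C2(1) by (intro divide_left_mono) auto
        then show "cmod (poly Q z) \<le> C2 / Suc n" using Q(2)[OF z] by linarith
        have "\<epsilon>\<^sup>2 \<le> 1" using eps by (simp add: power_le_one)
        then show "\<epsilon>\<^sup>2 / 2 \<le> 1" by simp
      qed (use eps C1 C2 in auto)
      also have "\<dots> \<le> C / Suc n" by (simp add: C_def add_divide_distrib)
      finally show ?thesis .
    qed
    have "poly (pderiv ?K) z = poly (smult (1/2) (?F * pderiv ?G - ?G * pderiv ?F)) z" for z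
    proof -
      have 1: "poly (pderiv K) z = (poly F z * poly (pderiv G) z - poly G z * poly (pderiv F) z) / 2"
        using K by (simp add: contact_poly_def)
      show ?thesis
        by (simp add: E_def P Q p1_def p2_def pderiv_add pderiv_smult pderiv_mult pderiv_diff 1 poly_monom power_add
              mult.commute[of pA] del: of_real_power)
           (simp add: field_simps power2_eq_square)
    qed
    then have cont: "contact_poly ?F ?G ?K" unfolding contact_poly_def by (intro poly_eq_poly_eq_iff[THEN iffD1] ext)
    have gd: "\<bar>gauge (poly ?F z) (poly ?G z) (poly ?K z) - gauge (poly F z) (poly G z) (poly K z)\<bar> \<le> 50000 * \<epsilon>\<^sup>2 + 200 * (C / Suc n)"
      if le: "C / Suc n \<le> 1" and z: "cmod z = 1" for z
    proof -
      define u where "u = z ^ (n + (d + d)) * dir1 (poly F z) (poly G z) (poly K z)"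
      define v where "v = z ^ (n + (d + d)) * dir2 (poly F z) (poly G z) (poly K z)"
      have u: "z ^ n * poly pA z = u" by (simp add: pA z u_def power_add)
      have v: "z ^ n * poly pB z = v" by (simp add: pB z v_def power_add)
      have e1: "poly ?F z = poly F z + of_real \<epsilon> * u" "poly ?G z = poly G z + of_real \<epsilon> * v"
        by (simp_all add: poly_monom u v)
      have e2: "poly ?K z = poly K z + of_real \<epsilon> * ((poly F z * v - poly G z * u) / 2) + poly E z"
        by (simp add: poly_monom u[symmetric] v[symmetric] field_simps)
      show ?thesis unfolding e1 e2
        by (rule gauge_step[OF _ _ _ _ _ le u_def v_def]) (use g[OF z] z eps Eb[of z] in \<open>auto simp: norm_power\<close>)
    qed
    show "\<exists>E. contact_poly (F + smult (of_real \<epsilon>) (monom 1 n * pA)) (G + smult (of_real \<epsilon>) (monom 1 n * pB))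
              (K + smult (of_real \<epsilon>) (monom 1 n * smult (1/2) (F * pB - G * pA)) + E) \<and>
          (\<forall>z. cmod z \<le> 1 \<longrightarrow> cmod (poly E z) \<le> C / Suc n) \<and>
          (C / Suc n \<le> 1 \<longrightarrow> (\<forall>z. cmod z = 1 \<longrightarrow>
             \<bar>gauge (poly (F + smult (of_real \<epsilon>) (monom 1 n * pA)) z) (poly (G + smult (of_real \<epsilon>) (monom 1 n * pB)) z)
                (poly (K + smult (of_real \<epsilon>) (monom 1 n * smult (1/2) (F * pB - G * pA)) + E) z)
              - gauge (poly F z) (poly G z) (poly K z)\<bar> \<le> 50000 * \<epsilon>\<^sup>2 + 200 * (C / Suc n)))"
      using cont Eb gd by blast
  qed
qed

text \<open>On the circle the norm is at least the root of 1/2, which exceeds 6/10. Uniform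
  continuity, applied to a point and its radial projection, costs at most 1/10.\<close>

lemma norm_pair_lower_near_circle:
  fixes p q :: "complex poly"
  assumes "\<And>z. cmod z = 1 \<Longrightarrow> 1/2 \<le> (cmod (poly p z))\<^sup>2 + (cmod (poly q z))\<^sup>2"
  obtains s where "0 < s" "s < 1" "\<And>z. s \<le> cmod z \<Longrightarrow> cmod z \<le> 1 \<Longrightarrow> 1/2 \<le> norm (poly p z, poly q z)"
proof -
  define h where "h z = norm (poly p z, poly q z)" for z
  have "uniformly_continuous_on (cball 0 1) h"
    unfolding h_def by (intro compact_uniformly_continuous compact_cball continuous_intros)
  then obtain \<delta> where \<delta>: "\<delta> > 0" "\<And>x y. x \<in> cball 0 1 \<Longrightarrow> y \<in> cball 0 1 \<Longrightarrow> dist y x < \<delta> \<Longrightarrow> dist (h y) (h x) < 1/10"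
    unfolding uniformly_continuous_on_def by (metis divide_pos_pos zero_less_one zero_less_numeral)
  show ?thesis
  proof (rule that[of "max (1/2) (1 - \<delta>/2)"])
    fix z assume z: "max (1/2) (1 - \<delta>/2) \<le> cmod z" "cmod z \<le> 1"
    define w where "w = z / of_real (cmod z)"
    have z0: "cmod z > 0" using z by linarith
    have w: "cmod w = 1" using z0 by (simp add: w_def norm_divide)
    have "w - z = of_real (1 - cmod z) * w" using z0 by (simp add: w_def field_simps)
    then have "cmod (w - z) = 1 - cmod z" using z w by (simp add: norm_mult del: of_real_diff)
    then have "dist w z < \<delta>" using z \<delta>(1) by (simp add: dist_norm)
    then have "dist (h w) (h z) < 1/10" using \<delta>(2)[of z w] z w by auto
    moreover have "(6/10)\<^sup>2 \<le> (h w)\<^sup>2" using assms[OF w] by (simp add: h_def norm_Pair power_divide)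
    then have "6/10 \<le> h w" by (rule power2_le_imp_le) (simp add: h_def)
    ultimately show "1/2 \<le> norm (poly p z, poly q z)" unfolding h_def[symmetric] dist_real_def by linarith
  qed (use \<delta> in auto)
qed

text \<open>The speed \<open>m\<close> can be made as large as desired by raising N, while the
  length gained, \<open>m * (b - a)\<close>, depends on \<open>\<epsilon>\<close> only. Large speeds
  are wanted because the later bounded changes of the derivatives, from the limit and from the
  linear terms, then cost only a fraction of the length.\<close>

lemma contact_step:
  fixes F G K :: "complex poly" and \<epsilon> \<eta> r M :: real
  assumes K: "contact_poly F G K"
    and g: "\<And>z. cmod z = 1 \<Longrightarrow> gauge (poly F z) (poly G z) (poly K z) \<in> {1/2..3/2}"
    and eps: "0 < \<epsilon>" "\<epsilon> \<le> 1" and \<eta>: "0 < \<eta>" and r: "0 \<le> r" "r < 1"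
  obtains F1 G1 K1 a b m where
    "contact_poly F1 G1 K1"
    "\<And>z. cmod z = 1 \<Longrightarrow> \<bar>gauge (poly F1 z) (poly G1 z) (poly K1 z) - gauge (poly F z) (poly G z) (poly K z)\<bar>
        \<le> 50000 * \<epsilon>\<^sup>2 + \<eta>"
    "\<And>z. cmod z \<le> r \<Longrightarrow> cmod (poly F1 z - poly F z) \<le> \<eta> \<and> cmod (poly G1 z - poly G z) \<le> \<eta> \<and> cmod (poly K1 z - poly K z) \<le> \<eta> \<and>
        cmod (poly (pderiv F1) z - poly (pderiv F) z) \<le> \<eta> \<and> cmod (poly (pderiv G1) z - poly (pderiv G) z) \<le> \<eta>"
    "r < a" "a < b" "b < 1" "M \<le> m" "m * (b - a) = \<epsilon> / 32"
    "\<And>z. a \<le> cmod z \<Longrightarrow> cmod z \<le> b \<Longrightarrow> m \<le> norm (poly (pderiv F1) z, poly (pderiv G1) z)"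
proof -
  obtain pA pB :: "complex poly" and C :: real where
    AB: "\<And>z. cmod z = 1 \<Longrightarrow> 1/2 \<le> (cmod (poly pA z))\<^sup>2 + (cmod (poly pB z))\<^sup>2"
    and C0: "C > 0" and pert:
    "\<And>n \<epsilon>. 0 < \<epsilon> \<Longrightarrow> \<epsilon> \<le> 1 \<Longrightarrow>
       \<exists>E. contact_poly (F + smult (of_real \<epsilon>) (monom 1 n * pA)) (G + smult (of_real \<epsilon>) (monom 1 n * pB))
              (K + smult (of_real \<epsilon>) (monom 1 n * smult (1/2) (F * pB - G * pA)) + E) \<and>
          (\<forall>z. cmod z \<le> 1 \<longrightarrow> cmod (poly E z) \<le> C / Suc n) \<and>
          (C / Suc n \<le> 1 \<longrightarrow> (\<forall>z. cmod z = 1 \<longrightarrow>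
             \<bar>gauge (poly (F + smult (of_real \<epsilon>) (monom 1 n * pA)) z) (poly (G + smult (of_real \<epsilon>) (monom 1 n * pB)) z)
                (poly (K + smult (of_real \<epsilon>) (monom 1 n * smult (1/2) (F * pB - G * pA)) + E) z)
              - gauge (poly F z) (poly G z) (poly K z)\<bar> \<le> 50000 * \<epsilon>\<^sup>2 + 200 * (C / Suc n)))"
    using contact_perturbation[OF K g] by blast
  obtain s where s: "0 < s" "s < 1" "\<And>z. s \<le> cmod z \<Longrightarrow> cmod z \<le> 1 \<Longrightarrow> 1/2 \<le> norm (poly pA z, poly pB z)"
    using norm_pair_lower_near_circle[OF AB] by blast
  obtain W1 where W1: "W1 > 0" "\<And>z. cmod z \<le> 1 \<Longrightarrow> cmod (poly (pderiv F) z) \<le> W1" using poly_bounded_on_disk by blast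
  obtain W2 where W2: "W2 > 0" "\<And>z. cmod z \<le> 1 \<Longrightarrow> cmod (poly (pderiv G) z) \<le> W2" using poly_bounded_on_disk by blast
  obtain W3 where W3: "W3 > 0" "\<And>z. cmod z \<le> 1 \<Longrightarrow> cmod (poly (pderiv pA) z) \<le> W3" using poly_bounded_on_disk by blast
  obtain W4 where W4: "W4 > 0" "\<And>z. cmod z \<le> 1 \<Longrightarrow> cmod (poly (pderiv pB) z) \<le> W4" using poly_bounded_on_disk by blast
  define W where "W = W1 + W2 + W3 + W4"
  have lim1: "(\<lambda>k. c / real (Suc k)) \<longlonglongrightarrow> 0" for c :: real
    using LIMSEQ_Suc[OF lim_const_over_n[of c]] by simp
  have lim2: "(\<lambda>k. C / real (Suc (Suc k))) \<longlonglongrightarrow> 0"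
    using LIMSEQ_Suc[OF lim1[of C]] by simp
  have top: "filterlim (\<lambda>k. c * real (Suc k)) at_top sequentially" if "c > 0" for c :: real
    using that by (intro filterlim_tendsto_pos_mult_at_top[OF tendsto_const]
        filterlim_compose[OF filterlim_real_sequentially filterlim_Suc])
  \<comment> \<open>Conditions on N = k + 1: \<open>e1\<close> bounds the error in \<open>K\<close>,
    both for the gauge estimate and below \<open>\<eta>\<close>; \<open>e2\<close> puts the annulus
    beyond \<open>r\<close> and into the region where \<open>pA\<close>, \<open>pB\<close> are not
    both small; \<open>e3\<close> lets the derivative of z^N dominate all other terms.\<close>
  have e1: "\<forall>\<^sub>F k in sequentially. C / real (Suc (Suc k)) < min 1 (\<eta> / 200)"
    using \<eta> by (intro order_tendstoD[OF lim2]) auto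
  have e2: "\<forall>\<^sub>F k in sequentially. 1 / real (Suc k) < 1 - max r s"
    using r s by (intro order_tendstoD[OF lim1]) auto
  have e3: "\<forall>\<^sub>F k in sequentially. max M W \<le> \<epsilon> / 8 * real (Suc k)"
    using top[of "\<epsilon> / 8"] eps unfolding filterlim_at_top by auto
  have half: "\<eta> / 2 > 0" using \<eta> by simp
  note e4 = monom_mult_small[OF r \<eta>, of pA] and e5 = monom_mult_small[OF r \<eta>, of pB]
    and e6 = monom_mult_small[OF r half, of "smult (1/2) (F * pB - G * pA)"]
  from eventually_happens'[OF sequentially_bot eventually_conj[OF e1 eventually_conj[OF e2
        eventually_conj[OF e3 eventually_conj[OF e4 eventually_conj[OF e5 e6]]]]]]
  obtain k where k1: "C / real (Suc (Suc k)) < min 1 (\<eta> / 200)" and k2: "1 / real (Suc k) < 1 - max r s"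
    and k3: "max M W \<le> \<epsilon> / 8 * real (Suc k)"
    and k4: "\<forall>z. cmod z \<le> r \<longrightarrow> cmod (poly (monom 1 (Suc k) * pA) z) \<le> \<eta> \<and> cmod (poly (pderiv (monom 1 (Suc k) * pA)) z) \<le> \<eta>"
    and k5: "\<forall>z. cmod z \<le> r \<longrightarrow> cmod (poly (monom 1 (Suc k) * pB) z) \<le> \<eta> \<and> cmod (poly (pderiv (monom 1 (Suc k) * pB)) z) \<le> \<eta>"
    and k6: "\<forall>z. cmod z \<le> r \<longrightarrow> cmod (poly (monom 1 (Suc k) * smult (1/2) (F * pB - G * pA)) z) \<le> \<eta> / 2"
    by blast
  define N where "N = Suc k"
  have N: "N > 0" by (simp add: N_def)
  note k2 = k2[folded N_def] and k3 = k3[folded N_def] and k4 = k4[folded N_def] and k5 = k5[folded N_def] and k6 = k6[folded N_def]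
  obtain E where E: "contact_poly (F + smult (of_real \<epsilon>) (monom 1 N * pA)) (G + smult (of_real \<epsilon>) (monom 1 N * pB))
              (K + smult (of_real \<epsilon>) (monom 1 N * smult (1/2) (F * pB - G * pA)) + E)"
    and E1: "\<And>z. cmod z \<le> 1 \<Longrightarrow> cmod (poly E z) \<le> C / Suc N"
    and E2: "C / Suc N \<le> 1 \<Longrightarrow> (\<forall>z. cmod z = 1 \<longrightarrow>
             \<bar>gauge (poly (F + smult (of_real \<epsilon>) (monom 1 N * pA)) z) (poly (G + smult (of_real \<epsilon>) (monom 1 N * pB)) z)
                (poly (K + smult (of_real \<epsilon>) (monom 1 N * smult (1/2) (F * pB - G * pA)) + E) z)
              - gauge (poly F z) (poly G z) (poly K z)\<bar> \<le> 50000 * \<epsilon>\<^sup>2 + 200 * (C / Suc N))"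
    using pert[OF eps, of N] by blast
  \<comment> \<open>For |z| at least \<open>a\<close>, Bernoulli's inequality gives |z|^N at least
    1/2. The width is 1 / (4 N), so the speed \<open>\<epsilon> / 8 * real N\<close> yields the
    length \<open>\<epsilon> / 32\<close>.\<close>
  define a where "a = 1 - 1 / (2 * real N)"
  define b where "b = 1 - 1 / (4 * real N)"
  show ?thesis
  proof (rule that[OF E, of a b "\<epsilon> / 8 * real N"])
    show "\<bar>gauge (poly (F + smult (of_real \<epsilon>) (monom 1 N * pA)) z) (poly (G + smult (of_real \<epsilon>) (monom 1 N * pB)) z)
                (poly (K + smult (of_real \<epsilon>) (monom 1 N * smult (1/2) (F * pB - G * pA)) + E) z)
              - gauge (poly F z) (poly G z) (poly K z)\<bar> \<le> 50000 * \<epsilon>\<^sup>2 + \<eta>" if "cmod z = 1" for z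
    proof -
      have "C / Suc N \<le> 1" "200 * (C / Suc N) \<le> \<eta>" using k1 by (auto simp: N_def mult.commute)
      then show ?thesis using E2 that by fastforce
    qed
    have scale: "cmod (of_real \<epsilon> * x) \<le> \<eta>" if "cmod x \<le> \<eta>" for x
      unfolding norm_mult using mult_mono[OF eps(2) that] eps \<eta> by simp
    have scale': "cmod (of_real \<epsilon> * x) \<le> \<eta> / 2" if "cmod x \<le> \<eta> / 2" for x
      unfolding norm_mult using mult_mono[OF eps(2) that] eps \<eta> by simp
    fix z assume z: "cmod z \<le> r"
    have "cmod (poly E z) \<le> C / real (Suc N)" using E1[of z] z r by auto
    also have "\<dots> < \<eta> / 200" using k1 by (simp add: N_def)
    finally have "cmod (poly E z) \<le> \<eta> / 2" using \<eta> by simp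
    with scale'[of "poly (monom 1 N * smult (1/2) (F * pB - G * pA)) z"] k6 z
    have "cmod (of_real \<epsilon> * poly (monom 1 N * smult (1/2) (F * pB - G * pA)) z + poly E z) \<le> \<eta> / 2 + \<eta> / 2"
      by (intro norm_triangle_le add_mono) auto
    moreover have "cmod (of_real \<epsilon> * poly (monom 1 N * pA) z) \<le> \<eta>" "cmod (of_real \<epsilon> * poly (monom 1 N * pB) z) \<le> \<eta>"
       "cmod (of_real \<epsilon> * poly (pderiv (monom 1 N * pA)) z) \<le> \<eta>" "cmod (of_real \<epsilon> * poly (pderiv (monom 1 N * pB)) z) \<le> \<eta>"
      using k4 k5 z by (auto intro!: scale simp del: poly_mult)
    ultimately show "cmod (poly (F + smult (of_real \<epsilon>) (monom 1 N * pA)) z - poly F z) \<le> \<eta> \<and>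
        cmod (poly (G + smult (of_real \<epsilon>) (monom 1 N * pB)) z - poly G z) \<le> \<eta> \<and>
        cmod (poly (K + smult (of_real \<epsilon>) (monom 1 N * smult (1/2) (F * pB - G * pA)) + E) z - poly K z) \<le> \<eta> \<and>
        cmod (poly (pderiv (F + smult (of_real \<epsilon>) (monom 1 N * pA))) z - poly (pderiv F) z) \<le> \<eta> \<and>
        cmod (poly (pderiv (G + smult (of_real \<epsilon>) (monom 1 N * pB))) z - poly (pderiv G) z) \<le> \<eta>"
      by (simp add: pderiv_add pderiv_smult add.assoc)
  next
    have "1 / (2 * real N) \<le> 1 / real N" using N by (intro divide_left_mono) auto
    then have as: "max r s < a" using k2 unfolding a_def by linarith
    then show "r < a" by simp
    show "a < b" using N unfolding a_def b_def by (simp add: field_simps)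
    show "b < 1" using N by (simp add: b_def)
    show "M \<le> \<epsilon> / 8 * real N" using k3 by simp
    show "\<epsilon> / 8 * real N * (b - a) = \<epsilon> / 32" using N by (simp add: a_def b_def field_simps)
    fix z assume z: "a \<le> cmod z" "cmod z \<le> b"
    have z1: "cmod z \<le> 1" using z \<open>b < 1\<close> by simp
    have "1 / (2 * real N) \<le> 1" using N by simp
    then have "1 + real N * (- (1 / (2 * real N))) \<le> (1 + (- (1 / (2 * real N)))) ^ N"
      by (intro Bernoulli_inequality) simp
    then have "1/2 \<le> a ^ N" using N by (simp add: a_def)
    also have "\<dots> \<le> cmod z ^ N" using z as r by (intro power_mono) auto
    also have "\<dots> \<le> cmod z ^ k" using z1 by (intro power_decreasing) (auto simp: N_def)
    finally have zk: "1/2 \<le> cmod z ^ k" .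
    have nAB: "1/2 \<le> norm (poly pA z, poly pB z)" using s(3)[of z] as z z1 by auto
    let ?V = "norm (of_real \<epsilon> * of_nat N * z ^ k * poly pA z, of_real \<epsilon> * of_nat N * z ^ k * poly pB z)"
    have "\<epsilon> * real N * ((1/2) * (1/2)) \<le> \<epsilon> * real N * (cmod z ^ k * norm (poly pA z, poly pB z))"
      using eps zk nAB by (intro mult_left_mono mult_mono) auto
    also have "\<dots> = ?V" unfolding norm_Pair_mult using eps by (simp add: norm_mult norm_power)
    finally have 1: "\<epsilon> * real N / 4 \<le> ?V" by simp
    have sm: "cmod (of_real \<epsilon> * z ^ N * x) \<le> cmod x" for x
    proof -
      have "\<epsilon> * cmod z ^ N \<le> 1 * 1" using eps z1 by (intro mult_mono power_le_one) auto
      then show ?thesis using mult_right_mono[of "\<epsilon> * cmod z ^ N" 1 "cmod x"] eps by (simp add: norm_mult norm_power)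
    qed
    have 2: "norm (poly (pderiv F) z, poly (pderiv G) z) \<le> W1 + W2"
      using norm_Pair_le[of "poly (pderiv F) z" "poly (pderiv G) z"] W1(2)[OF z1] W2(2)[OF z1] by linarith
    have 3: "norm (of_real \<epsilon> * z ^ N * poly (pderiv pA) z, of_real \<epsilon> * z ^ N * poly (pderiv pB) z) \<le> W3 + W4"
      using norm_Pair_le[of "of_real \<epsilon> * z ^ N * poly (pderiv pA) z" "of_real \<epsilon> * z ^ N * poly (pderiv pB) z"]
        sm[of "poly (pderiv pA) z"] sm[of "poly (pderiv pB) z"] W3(2)[OF z1] W4(2)[OF z1] by linarith
    \<comment> \<open>\<open>V\<close> collects the terms in which z^N is differentiated and has
      norm at least \<open>\<epsilon> * real N / 4\<close>; the old derivative \<open>X\<close> and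
      the remainder \<open>Y\<close> together stay below half of that.\<close>
    define V where "V = (of_real \<epsilon> * of_nat N * z ^ k * poly pA z, of_real \<epsilon> * of_nat N * z ^ k * poly pB z)"
    define X where "X = (poly (pderiv F) z, poly (pderiv G) z)"
    define Y where "Y = (of_real \<epsilon> * z ^ N * poly (pderiv pA) z, of_real \<epsilon> * z ^ N * poly (pderiv pB) z)"
    have eq: "(poly (pderiv (F + smult (of_real \<epsilon>) (monom 1 N * pA))) z,
        poly (pderiv (G + smult (of_real \<epsilon>) (monom 1 N * pB))) z) = V - (- X - Y)"
      by (simp add: V_def X_def Y_def N_def pderiv_add pderiv_smult pderiv_mult pderiv_monom poly_monom algebra_simps)
    have "norm V - norm (- X - Y) \<le> norm (V - (- X - Y))" by (rule norm_triangle_ineq2)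
    moreover have "norm (- X - Y) \<le> norm X + norm Y" using norm_triangle_ineq4[of "- X" Y] by simp
    ultimately have "norm V - norm X - norm Y \<le> norm (V - (- X - Y))" by linarith
    moreover have "norm V - norm X - norm Y \<ge> \<epsilon> * real N / 4 - W"
      using 1 2 3 unfolding V_def X_def Y_def W_def by linarith
    moreover have "W \<le> \<epsilon> * real N / 8" using k3 by simp
    ultimately show "\<epsilon> / 8 * real N \<le> norm (poly (pderiv (F + smult (of_real \<epsilon>) (monom 1 N * pA))) z,
        poly (pderiv (G + smult (of_real \<epsilon>) (monom 1 N * pB))) z)"
      unfolding eq by (simp add: field_simps)
  qed
qed

section \<open>Passage to the limit\<close>

text \<open>Step n is controlled only on the disk of radius \<open>r n\<close>, but a fixed smaller
  disk is covered by all later steps. This gives the M-test there, and locally uniform convergence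
  carries over to the derivatives.\<close>

lemma poly_sequence_limit:
  fixes p :: "nat \<Rightarrow> complex poly"
  assumes r: "incseq r" "r \<longlonglongrightarrow> 1" "\<And>n. r n < 1" and e: "summable e"
    and p: "\<And>n z. cmod z \<le> r n \<Longrightarrow> cmod (poly (p (Suc n)) z - poly (p n) z) \<le> e n"
  obtains f where "f holomorphic_on unit_disk"
    "\<And>z. z \<in> unit_disk \<Longrightarrow> (\<lambda>n. poly (p n) z) \<longlonglongrightarrow> f z"
    "\<And>z. z \<in> unit_disk \<Longrightarrow> (\<lambda>n. poly (pderiv (p n)) z) \<longlonglongrightarrow> deriv f z"
proof -
  define f where "f z = poly (p 0) z + (\<Sum>i. poly (p (Suc i)) z - poly (p i) z)" for z
  have unif: "uniform_limit (cball 0 (r m)) (\<lambda>n z. poly (p n) z) f sequentially" for m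
  proof -
    have "\<forall>\<^sub>F n in sequentially. \<forall>z\<in>cball 0 (r m). norm (poly (p (Suc n)) z - poly (p n) z) \<le> e n"
      unfolding eventually_sequentially by (intro exI[of _ m]) (auto intro!: p intro: order_trans[OF _ incseqD[OF r(1)]])
    then have "uniform_limit (cball 0 (r m)) (\<lambda>n z. \<Sum>i<n. poly (p (Suc i)) z - poly (p i) z)
        (\<lambda>z. \<Sum>i. poly (p (Suc i)) z - poly (p i) z) sequentially"
      by (rule Weierstrass_m_test_ev[OF _ e])
    then have "uniform_limit (cball 0 (r m)) (\<lambda>n z. poly (p 0) z + (\<Sum>i<n. poly (p (Suc i)) z - poly (p i) z)) f sequentially"
      unfolding f_def by (intro uniform_limit_intros)
    moreover have "poly (p 0) z + (\<Sum>i<n. poly (p (Suc i)) z - poly (p i) z) = poly (p n) z" for n z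
      using sum_lessThan_telescope[of "\<lambda>i. poly (p i) z" n] by simp
    ultimately show ?thesis by (simp only:)
  qed
  have inside: "\<exists>m. cmod z < r m" if "z \<in> unit_disk" for z
    using order_tendstoD(1)[OF r(2), of "cmod z"] that by (auto simp: eventually_sequentially)
  have loc: "\<exists>d. 0 < d \<and> cball z d \<subseteq> unit_disk \<and> uniform_limit (cball z d) (\<lambda>n z. poly (p n) z) f sequentially"
    if z: "z \<in> unit_disk" for z
  proof -
    obtain m where m: "cmod z < r m" using inside[OF z] by blast
    have sub: "cball z (r m - cmod z) \<subseteq> cball 0 (r m)"
    proof
      fix y assume "y \<in> cball z (r m - cmod z)"
      then show "y \<in> cball 0 (r m)" using norm_triangle_sub[of y z] by (auto simp: dist_norm norm_minus_commute)
    qed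
    moreover have "cball 0 (r m) \<subseteq> unit_disk" using r(3)[of m] by auto
    ultimately show ?thesis using m uniform_limit_on_subset[OF unif[of m] sub]
      by (intro exI[of _ "r m - cmod z"]) auto
  qed
  obtain f' where f': "\<And>z. z \<in> unit_disk \<Longrightarrow> (f has_field_derivative f' z) (at z)"
    "\<And>z. z \<in> unit_disk \<Longrightarrow> (\<lambda>n. poly (pderiv (p n)) z) \<longlonglongrightarrow> f' z"
    using has_complex_derivative_uniform_sequence[OF open_ball poly_DERIV loc] by blast
  show ?thesis
  proof (rule that[of f])
    show "f holomorphic_on unit_disk"
      unfolding holomorphic_on_open[OF open_ball] using f'(1) by blast
    show "(\<lambda>n. poly (p n) z) \<longlonglongrightarrow> f z" if z: "z \<in> unit_disk" for z
    proof -
      obtain m where "cmod z < r m" using inside[OF z] by blast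
      then show ?thesis using tendsto_uniform_limitI[OF unif[of m]] by simp
    qed
    show "(\<lambda>n. poly (pderiv (p n)) z) \<longlonglongrightarrow> deriv f z" if z: "z \<in> unit_disk" for z
      using f'(2)[OF z] DERIV_imp_deriv[OF f'(1)[OF z]] by simp
  qed
qed

lemma tendsto_dist_le_suminf:
  fixes x :: "nat \<Rightarrow> 'a::real_normed_vector"
  assumes "x \<longlonglongrightarrow> l" and "summable e" and e: "\<And>n. 0 \<le> e n" and d: "\<And>n. n \<ge> k \<Longrightarrow> norm (x (Suc n) - x n) \<le> e n"
  shows "norm (l - x k) \<le> suminf e"
proof (rule LIMSEQ_le_const2)
  show "(\<lambda>n. norm (x n - x k)) \<longlonglongrightarrow> norm (l - x k)" by (intro tendsto_intros assms)
  have "norm (x (k + j) - x k) \<le> (\<Sum>i<k + j. e i)" for j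
  proof (induction j)
    case 0
    show ?case using e by (auto intro: sum_nonneg)
  next
    case (Suc j)
    then show ?case using d[of "k + j"] norm_triangle_ineq[of "x (k + Suc j) - x (k + j)" "x (k + j) - x k"] by simp
  qed
  then have "norm (x n - x k) \<le> suminf e" if "n \<ge> k" for n
    using that sum_le_suminf[OF assms(2), of "{..<n}"] e by (metis finite_lessThan le_add_diff_inverse order_trans)
  then show "\<exists>N. \<forall>n\<ge>N. norm (x n - x k) \<le> suminf e" by blast
qed

lemma poly_bounded_by_circle:
  fixes p :: "complex poly"
  assumes "\<And>z. cmod z = 1 \<Longrightarrow> cmod (poly p z) \<le> B" and "cmod z \<le> 1"
  shows "cmod (poly p z) \<le> B"
proof (rule maximum_modulus_frontier[of "poly p" "cball 0 1"])
  show "poly p holomorphic_on interior (cball 0 1)" by (intro holomorphic_intros)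
qed (use assms in \<open>auto intro!: continuous_intros\<close>)

text \<open>The tolerance \<open>1 / ((n+1) (n+2)) / 8\<close> telescopes, so that the gauge stays within
  \<open>1/2 - 1 / (4 (n+1))\<close> of \<open>1\<close> after \<open>n\<close> steps.\<close>

definition tolerance :: "nat \<Rightarrow> real" where
  "tolerance n = 1 / ((real n + 1) * (real n + 2)) / 8"

lemma tolerance_pos: "0 < tolerance n"
  by (simp add: tolerance_def)

text \<open>Twice, because each step spends one tolerance on the second-order change of the gauge
  and one on the error \<open>\<eta>\<close>.\<close>

lemma tolerance_telescope: "2 * tolerance n = 1 / (4 * (real n + 1)) - 1 / (4 * (real (Suc n) + 1))"
  by (simp add: tolerance_def divide_simps) (simp add: algebra_simps)

lemma tolerance_sums: "tolerance sums (1/8)"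
proof -
  have "(\<lambda>n. 1 / (real n + 1)) \<longlonglongrightarrow> 0"
    using LIMSEQ_Suc[OF lim_const_over_n[of 1]] by (simp add: add.commute)
  then have "(\<lambda>n. 1/8 * (1 / (real n + 1))) \<longlonglongrightarrow> 1/8 * 0" by (intro tendsto_intros)
  then have "(\<lambda>n. 1/8 * (1 / (real n + 1)) - 1/8 * (1 / (real (Suc n) + 1))) sums (1/8 * (1 / (real 0 + 1)) - 0)"
    by (intro telescope_sums') simp
  also have "(\<lambda>n. 1/8 * (1 / (real n + 1)) - 1/8 * (1 / (real (Suc n) + 1))) = tolerance"
    by (rule ext) (simp add: tolerance_def divide_simps, simp add: algebra_simps)
  finally show ?thesis by simp
qed

text \<open>The n-th annulus lies between radii \<open>r n\<close> and \<open>r (Suc n)\<close>: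
  outside the disk that step n must leave nearly unchanged, and inside every disk protected by later
  steps.\<close>

lemma contact_sequence:
  obtains F G K :: "nat \<Rightarrow> complex poly" and r a m :: "nat \<Rightarrow> real" where
    "\<And>n. contact_poly (F n) (G n) (K n)"
    "\<And>n z. cmod z = 1 \<Longrightarrow> gauge (poly (F n) z) (poly (G n) z) (poly (K n) z) \<le> 3/2"
    "\<And>n z. cmod z \<le> r n \<Longrightarrow> cmod (poly (F (Suc n)) z - poly (F n) z) \<le> tolerance n \<and>
       cmod (poly (G (Suc n)) z - poly (G n) z) \<le> tolerance n \<and> cmod (poly (K (Suc n)) z - poly (K n) z) \<le> tolerance n \<and>
       cmod (poly (pderiv (F (Suc n))) z - poly (pderiv (F n)) z) \<le> tolerance n \<and>
       cmod (poly (pderiv (G (Suc n))) z - poly (pderiv (G n)) z) \<le> tolerance n"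
    "\<And>n. 0 \<le> r n" "\<And>n. r n < a n" "\<And>n. a n < r (Suc n)" "\<And>n. r n < 1" "\<And>n. 1 - 1 / real (Suc n) < a n"
    "\<And>n. real n \<le> m n" "\<And>n. m n * (r (Suc n) - a n) = 1 / (32000 * (real n + 2))"
    "\<And>n z. a n \<le> cmod z \<Longrightarrow> cmod z \<le> r (Suc n) \<Longrightarrow>
       m n \<le> norm (poly (pderiv (F (Suc n))) z, poly (pderiv (G (Suc n))) z)"
proof -
  define P where "P n s = (case s of (F, G, K, r) \<Rightarrow> contact_poly F G K \<and> 0 \<le> r \<and> r < 1 \<and>
     (\<forall>z. cmod z = 1 \<longrightarrow> \<bar>gauge (poly F z) (poly G z) (poly K z) - 1\<bar> \<le> 1/2 - 1 / (4 * (real n + 1))))" 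
    for n and s :: "complex poly \<times> complex poly \<times> complex poly \<times> real"
  define Q where "Q n s s' = (case (s, s') of ((F, G, K, r), (F1, G1, K1, r1)) \<Rightarrow>
     (\<forall>z. cmod z \<le> r \<longrightarrow> cmod (poly F1 z - poly F z) \<le> tolerance n \<and>
       cmod (poly G1 z - poly G z) \<le> tolerance n \<and> cmod (poly K1 z - poly K z) \<le> tolerance n \<and>
       cmod (poly (pderiv F1) z - poly (pderiv F) z) \<le> tolerance n \<and>
       cmod (poly (pderiv G1) z - poly (pderiv G) z) \<le> tolerance n) \<and>
     (\<exists>a m. r < a \<and> a < r1 \<and> 1 - 1 / real (Suc n) < a \<and> real n \<le> m \<and> m * (r1 - a) = 1 / (32000 * (real n + 2)) \<and>
       (\<forall>z. a \<le> cmod z \<longrightarrow> cmod z \<le> r1 \<longrightarrow> m \<le> norm (poly (pderiv F1) z, poly (pderiv G1) z))))"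
    for n and s s' :: "complex poly \<times> complex poly \<times> complex poly \<times> real"
  have half: "1/2 - 1 / (4 * (real n + 1)) \<le> 1/2" for n by simp
  have "\<exists>f. \<forall>n. P n (f n) \<and> Q n (f n) (f (Suc n))"
  proof (rule dependent_nat_choice)
    \<comment> \<open>The constant triple (sqrt 3, 0, 1) has gauge exactly 1.\<close>
    have "(cmod (of_real (sqrt 3)))\<^sup>2 = 3" by simp
    then have "P 0 ([:of_real (sqrt 3):], 0, 1, 0)"
      by (simp add: P_def contact_poly_def gauge_def pderiv_pCons)
    then show "\<exists>s. P 0 s" by blast
  next
    fix s n assume "P n s"
    then obtain F G K r where s: "s = (F, G, K, r)" and K: "contact_poly F G K" and r: "0 \<le> r" "r < 1"
      and g: "\<And>z. cmod z = 1 \<Longrightarrow> \<bar>gauge (poly F z) (poly G z) (poly K z) - 1\<bar> \<le> 1/2 - 1 / (4 * (real n + 1))"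
      by (cases s) (auto simp: P_def)
    have g': "gauge (poly F z) (poly G z) (poly K z) \<in> {1/2..3/2}" if "cmod z = 1" for z
      using order_trans[OF g[OF that] half[of n]] unfolding atLeastAtMost_iff by linarith
    \<comment> \<open>The factor 1000 makes \<open>50000 * \<epsilon>\<^sup>2\<close> at most
      \<open>tolerance n\<close>, while the sum over n still diverges.\<close>
    define \<epsilon> where "\<epsilon> = 1 / (1000 * (real n + 2))"
    \<comment> \<open>The second entry drives the annuli towards the circle.\<close>
    define R where "R = max r (1 - 1 / real (Suc n))"
    have eps: "0 < \<epsilon>" "\<epsilon> \<le> 1" by (auto simp: \<epsilon>_def)
    have R: "0 \<le> R" "R < 1" using r by (auto simp: R_def)
    obtain F1 G1 K1 a b m where st: "contact_poly F1 G1 K1"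
      "\<And>z. cmod z = 1 \<Longrightarrow> \<bar>gauge (poly F1 z) (poly G1 z) (poly K1 z) - gauge (poly F z) (poly G z) (poly K z)\<bar>
        \<le> 50000 * \<epsilon>\<^sup>2 + tolerance n"
      "\<And>z. cmod z \<le> R \<Longrightarrow> cmod (poly F1 z - poly F z) \<le> tolerance n \<and> cmod (poly G1 z - poly G z) \<le> tolerance n \<and>
        cmod (poly K1 z - poly K z) \<le> tolerance n \<and>
        cmod (poly (pderiv F1) z - poly (pderiv F) z) \<le> tolerance n \<and> cmod (poly (pderiv G1) z - poly (pderiv G) z) \<le> tolerance n"
      "R < a" "a < b" "b < 1" "real n \<le> m" "m * (b - a) = \<epsilon> / 32"
      "\<And>z. a \<le> cmod z \<Longrightarrow> cmod z \<le> b \<Longrightarrow> m \<le> norm (poly (pderiv F1) z, poly (pderiv G1) z)"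
      using contact_step[OF K g' eps tolerance_pos R] by metis
    have "\<epsilon>\<^sup>2 = (1/1000000) * (1 / ((real n + 2) * (real n + 2)))" by (simp add: \<epsilon>_def power2_eq_square) (simp add: algebra_simps)
    moreover have "1 / ((real n + 2) * (real n + 2)) \<le> 1 / ((real n + 1) * (real n + 2))"
      by (intro divide_left_mono mult_right_mono) auto
    moreover have "1 / ((real n + 1) * (real n + 2)) = 8 * tolerance n" by (simp add: tolerance_def)
    ultimately have "50000 * \<epsilon>\<^sup>2 \<le> tolerance n" using tolerance_pos[of n] by linarith
    then have "\<bar>gauge (poly F1 z) (poly G1 z) (poly K1 z) - 1\<bar> \<le> 1/2 - 1 / (4 * (real (Suc n) + 1))" if "cmod z = 1" for z
      using st(2)[OF that] g[OF that] tolerance_telescope[of n] by linarith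
    then have "P (Suc n) (F1, G1, K1, b)" using st R by (simp add: P_def)
    moreover have "Q n s (F1, G1, K1, b)"
    proof -
      have "r < a" "1 - 1 / real (Suc n) < a" using st(4) by (simp_all add: R_def)
      moreover have "m * (b - a) = 1 / (32000 * (real n + 2))" using st(8) by (simp add: \<epsilon>_def)
      moreover have "cmod z \<le> R" if "cmod z \<le> r" for z using that by (simp add: R_def)
      ultimately show ?thesis unfolding Q_def s prod.case using st(3,5,7,9) by blast
    qed
    ultimately show "\<exists>y. P (Suc n) y \<and> Q n s y" by blast
  qed
  then obtain f where PQ: "\<And>n. P n (f n)" "\<And>n. Q n (f n) (f (Suc n))" by blast
  define F where "F n = fst (f n)" for n
  define G where "G n = fst (snd (f n))" for n
  define K where "K n = fst (snd (snd (f n)))" for n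
  define r where "r n = snd (snd (snd (f n)))" for n
  have f: "f n = (F n, G n, K n, r n)" for n by (simp add: F_def G_def K_def r_def)
  note P = PQ(1)[unfolded f P_def prod.case] and Q = PQ(2)[unfolded f Q_def prod.case]
  define B where "B n a m \<longleftrightarrow> r n < a \<and> a < r (Suc n) \<and> 1 - 1 / real (Suc n) < a \<and> real n \<le> m \<and>
       m * (r (Suc n) - a) = 1 / (32000 * (real n + 2)) \<and>
       (\<forall>z. a \<le> cmod z \<longrightarrow> cmod z \<le> r (Suc n) \<longrightarrow> m \<le> norm (poly (pderiv (F (Suc n))) z, poly (pderiv (G (Suc n))) z))"
    for n a m
  have "\<exists>a m. B n a m" for n using Q[of n] unfolding B_def by (rule conjunct2)
  then obtain a m where "\<And>n. B n (a n) (m n)" by metis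
  note am = this[unfolded B_def]
  show ?thesis
  proof (rule that[of F G K r a m])
    show "gauge (poly (F n) z) (poly (G n) z) (poly (K n) z) \<le> 3/2" if "cmod z = 1" for n z
    proof -
      have "\<bar>gauge (poly (F n) z) (poly (G n) z) (poly (K n) z) - 1\<bar> \<le> 1/2 - 1 / (4 * (real n + 1))"
        using P[of n] that by blast
      then show ?thesis using half[of n] by linarith
    qed
  qed (use P Q am in auto)
qed

section \<open>Weighted path lengths\<close>

lemma valid_path_derivative:
  assumes "valid_path \<gamma>"
  shows "\<exists>D S. finite S \<and> continuous_on ({0..1} - S) D \<and>
           (\<forall>t\<in>{0..1} - S. (\<gamma> has_vector_derivative D t) (at t))"
  using assms unfolding valid_path_def piecewise_C1_differentiable_on_def C1_differentiable_on_def by blast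

text \<open>Length for the conformal metric w^2 |dz|^2; the metric of the front has this form with w
  the norm of (F', G').\<close>

definition weighted_length :: "(complex \<Rightarrow> real) \<Rightarrow> (real \<Rightarrow> complex) \<Rightarrow> ennreal" where
  "weighted_length w \<gamma> = (\<integral>\<^sup>+t\<in>{0..1}. ennreal (w (\<gamma> t) * cmod (vector_derivative \<gamma> (at t within {0..1}))) \<partial>lborel)"

text \<open>A finite set is null, and away from it \<open>D\<close> is the derivative. The gain is
  measurability: \<open>D\<close> is continuous off \<open>S\<close>, whereas nothing is known about
  the values of \<open>vector_derivative\<close> at the break points.\<close>

lemma weighted_length_eq:
  assumes S: "finite S" and D: "\<And>t. t \<in> {0..1} - S \<Longrightarrow> (\<gamma> has_vector_derivative D t) (at t)"
  shows "weighted_length w \<gamma> = (\<integral>\<^sup>+t. ennreal (w (\<gamma> t) * cmod (D t)) * indicator ({0..1} - S) t \<partial>lborel)"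
  unfolding weighted_length_def
proof (intro nn_integral_cong_AE AE_I')
  show "S \<in> null_sets lborel" using S by (rule finite_imp_null_set_lborel)
  show "{t \<in> space lborel. ennreal (w (\<gamma> t) * cmod (vector_derivative \<gamma> (at t within {0..1}))) * indicator {0..1} t
      \<noteq> ennreal (w (\<gamma> t) * cmod (D t)) * indicator ({0..1} - S) t} \<subseteq> S"
  proof (clarsimp, rule ccontr)
    fix t assume ne: "ennreal (w (\<gamma> t) * cmod (vector_derivative \<gamma> (at t within {0..1}))) * indicator {0..1} t
      \<noteq> ennreal (w (\<gamma> t) * cmod (D t)) * indicator ({0..1} - S) t" and t: "t \<notin> S"
    have "t \<in> {0..1} - S" using ne t by (cases "t \<in> {0..1}") auto
    then have "vector_derivative \<gamma> (at t within {0..1}) = D t"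
      using D[of t] by (intro vector_derivative_at_within_ivl) auto
    then show False using ne t by (auto simp: indicator_def split: if_splits)
  qed
qed

lemma borel_closed_diff_finite:
  assumes "closed A" and "finite S"
  shows "A - S \<in> sets (borel :: 'a::t1_space measure)"
  by (rule sets.Diff[OF borel_closed[OF assms(1)] borel_closed[OF finite_imp_closed[OF assms(2)]]])

lemma weighted_length_measurable:
  fixes \<gamma> :: "real \<Rightarrow> complex"
  assumes S: "finite S" and D: "continuous_on ({0..1} - S) D" and \<gamma>: "continuous_on {0..1} \<gamma>" "\<gamma> ` {0..1} \<subseteq> U"
    and w: "continuous_on U w"
  shows "(\<lambda>t. ennreal (w (\<gamma> t) * cmod (D t)) * indicator ({0..1} - S) t) \<in> borel_measurable borel"
proof -
  have "{0..1} - S \<in> sets borel" using S by (intro borel_closed_diff_finite) auto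
  moreover have "continuous_on ({0..1} - S) (\<lambda>t. w (\<gamma> t) * cmod (D t))"
    using \<gamma> by (intro continuous_intros D continuous_on_compose2[OF w] continuous_on_subset[OF \<gamma>(1)]) auto
  ultimately have "(\<lambda>t. indicator ({0..1} - S) t *\<^sub>R (w (\<gamma> t) * cmod (D t))) \<in> borel_measurable borel"
    by (rule borel_measurable_continuous_on_indicator)
  then have "(\<lambda>t. ennreal (indicator ({0..1} - S) t *\<^sub>R (w (\<gamma> t) * cmod (D t)))) \<in> borel_measurable borel" by simp
  also have "(\<lambda>t. ennreal (indicator ({0..1} - S) t *\<^sub>R (w (\<gamma> t) * cmod (D t))))
      = (\<lambda>t. ennreal (w (\<gamma> t) * cmod (D t)) * indicator ({0..1} - S) t)"
    by (auto simp: indicator_def)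
  finally show ?thesis .
qed

text \<open>\<open>D\<close> may be unbounded near \<open>S\<close>, so integrability is not
  automatic. If the integral is infinite there is nothing to show; otherwise \<open>D\<close> is
  Lebesgue integrable and the fundamental theorem with finitely many exceptional points
  applies.\<close>

lemma chord_le_length:
  fixes \<gamma> :: "real \<Rightarrow> complex"
  assumes S: "finite S" and D: "continuous_on ({0..1} - S) D"
    and d: "\<And>t. t \<in> {0..1} - S \<Longrightarrow> (\<gamma> has_vector_derivative D t) (at t)"
    and \<gamma>: "continuous_on {0..1} \<gamma>" and st: "0 \<le> s" "s \<le> t" "t \<le> 1"
  shows "ennreal (cmod (\<gamma> t - \<gamma> s)) \<le> (\<integral>\<^sup>+u. ennreal (cmod (D u)) * indicator ({s..t} - S) u \<partial>lborel)"
proof (cases "(\<integral>\<^sup>+u. ennreal (cmod (D u)) * indicator ({s..t} - S) u \<partial>lborel) = \<infinity>")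
  case False
  define g where "g u = indicator ({s..t} - S) u *\<^sub>R D u" for u
  have "{s..t} - S \<in> sets borel" using S by (intro borel_closed_diff_finite) auto
  moreover have "continuous_on ({s..t} - S) D" using st by (intro continuous_on_subset[OF D]) auto
  ultimately have gm: "g \<in> borel_measurable borel"
    unfolding g_def by (rule borel_measurable_continuous_on_indicator)
  have ng: "(\<integral>\<^sup>+u. ennreal (norm (g u)) \<partial>lborel) = (\<integral>\<^sup>+u. ennreal (cmod (D u)) * indicator ({s..t} - S) u \<partial>lborel)"
    by (intro nn_integral_cong) (auto simp: g_def indicator_def)
  have int: "integrable lborel g" unfolding integrable_iff_bounded ng using gm False by (auto simp: less_top)
  have "(D has_integral (\<gamma> t - \<gamma> s)) {s..t}"
    using st by (intro fundamental_theorem_of_calculus_strong[OF S] d continuous_on_subset[OF \<gamma>]) auto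
  then have "(g has_integral (\<gamma> t - \<gamma> s)) {s..t}"
    by (rule has_integral_spike_finite[OF S, rotated]) (auto simp: g_def)
  then have "((\<lambda>u. if u \<in> {s..t} then g u else 0) has_integral (\<gamma> t - \<gamma> s)) UNIV"
    by (simp only: has_integral_restrict_UNIV)
  also have "(\<lambda>u. if u \<in> {s..t} then g u else 0) = g" by (auto simp: g_def indicator_def)
  finally have "\<gamma> t - \<gamma> s = integral\<^sup>L lborel g"
    using has_integral_integral_lborel[OF int] by (rule has_integral_unique)
  then show ?thesis using integral_norm_bound_ennreal[OF int] unfolding ng by simp
qed simp

text \<open>Only the portion of the path between the last visit to the inner disk and the first exit from
  the outer one is measured.\<close>

lemma annulus_crossing_length:
  fixes \<gamma> :: "real \<Rightarrow> complex"
  assumes S: "finite S" and D: "continuous_on ({0..1} - S) D"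
    and d: "\<And>t. t \<in> {0..1} - S \<Longrightarrow> (\<gamma> has_vector_derivative D t) (at t)"
    and \<gamma>: "continuous_on {0..1} \<gamma>"
    and a: "cmod (\<gamma> 0 - c) \<le> a" and b: "b \<le> cmod (\<gamma> 1 - c)"
  shows "ennreal (b - a) \<le> (\<integral>\<^sup>+u. ennreal (cmod (D u)) *
           indicator {u \<in> {0..1} - S. a \<le> cmod (\<gamma> u - c) \<and> cmod (\<gamma> u - c) \<le> b} u \<partial>lborel)"
proof -
  define h where "h t = cmod (\<gamma> t - c)" for t
  have h: "continuous_on {0..1} h" unfolding h_def by (intro continuous_intros \<gamma>)
  have "closed ({0..1} \<inter> h -` {b..})" by (intro continuous_closed_preimage h) auto
  then have "compact ({0..1} \<inter> ({0..1} \<inter> h -` {b..}))" by (intro compact_Int_closed) auto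
  moreover have "1 \<in> {0..1} \<inter> ({0..1} \<inter> h -` {b..})" using b by (auto simp: h_def)
  ultimately obtain t where "t \<in> {0..1} \<inter> ({0..1} \<inter> h -` {b..})" "\<forall>u\<in>{0..1} \<inter> ({0..1} \<inter> h -` {b..}). t \<le> u"
    using compact_attains_inf by blast
  then have t: "t \<in> {0..1}" "b \<le> h t" and tmin: "\<And>u. u \<in> {0..1} \<Longrightarrow> b \<le> h u \<Longrightarrow> t \<le> u" by auto
  have h': "continuous_on {0..t} h" using t by (intro continuous_on_subset[OF h]) auto
  have "closed ({0..t} \<inter> h -` {..a})" by (intro continuous_closed_preimage h') auto
  then have "compact ({0..t} \<inter> ({0..t} \<inter> h -` {..a}))" by (intro compact_Int_closed) auto
  moreover have "0 \<in> {0..t} \<inter> ({0..t} \<inter> h -` {..a})" using a t by (auto simp: h_def)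
  ultimately obtain s where "s \<in> {0..t} \<inter> ({0..t} \<inter> h -` {..a})" "\<forall>u\<in>{0..t} \<inter> ({0..t} \<inter> h -` {..a}). u \<le> s"
    using compact_attains_sup by blast
  then have s: "s \<in> {0..t}" "h s \<le> a" and smax: "\<And>u. u \<in> {0..t} \<Longrightarrow> h u \<le> a \<Longrightarrow> u \<le> s" by auto
  have "b - a \<le> cmod (\<gamma> t - \<gamma> s)"
    using t s norm_triangle_ineq2[of "\<gamma> t - c" "\<gamma> s - c"] by (simp add: h_def)
  then have "ennreal (b - a) \<le> ennreal (cmod (\<gamma> t - \<gamma> s))" by (rule ennreal_leI)
  \<comment> \<open>Removing the endpoints as well leaves only times strictly after the last visit
    and strictly before the first exit, where the path is certainly in the annulus.\<close>
  also have "\<dots> \<le> (\<integral>\<^sup>+u. ennreal (cmod (D u)) * indicator ({s..t} - (S \<union> {s, t})) u \<partial>lborel)"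
    using S t s by (intro chord_le_length d \<gamma> continuous_on_subset[OF D]) auto
  also have "\<dots> \<le> (\<integral>\<^sup>+u. ennreal (cmod (D u)) *
           indicator {u \<in> {0..1} - S. a \<le> cmod (\<gamma> u - c) \<and> cmod (\<gamma> u - c) \<le> b} u \<partial>lborel)"
  proof (intro nn_integral_mono mult_left_mono indicator_leI)
    fix u assume u: "u \<in> {s..t} - (S \<union> {s, t})"
    then have "u \<in> {0..1} - S" "u < t" "s < u" using s t by auto
    then show "u \<in> {u \<in> {0..1} - S. a \<le> cmod (\<gamma> u - c) \<and> cmod (\<gamma> u - c) \<le> b}"
      using tmin[of u] smax[of u] s t unfolding h_def by fastforce
  qed auto
  finally show ?thesis .
qed

text \<open>Serves twice: with c = 0 and many annuli for completeness, and with a single disk about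
  a point, an annulus of inner radius 0, for positivity of the distance.\<close>

lemma weighted_length_ge_annuli:
  assumes \<gamma>: "valid_path \<gamma>" "path_image \<gamma> \<subseteq> U" and w: "continuous_on U w" "\<And>z. z \<in> U \<Longrightarrow> 0 \<le> w z"
    and I: "finite I" and m: "\<And>i. i \<in> I \<Longrightarrow> 0 \<le> m i"
    and disj: "\<And>i j z. i \<in> I \<Longrightarrow> j \<in> I \<Longrightarrow> a i \<le> cmod (z - c) \<Longrightarrow> cmod (z - c) \<le> b i \<Longrightarrow>
        a j \<le> cmod (z - c) \<Longrightarrow> cmod (z - c) \<le> b j \<Longrightarrow> i = j"
    and wm: "\<And>i z. i \<in> I \<Longrightarrow> z \<in> U \<Longrightarrow> a i \<le> cmod (z - c) \<Longrightarrow> cmod (z - c) \<le> b i \<Longrightarrow> m i \<le> w z"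
    and st: "\<And>i. i \<in> I \<Longrightarrow> cmod (pathstart \<gamma> - c) \<le> a i" and fi: "\<And>i. i \<in> I \<Longrightarrow> b i \<le> cmod (pathfinish \<gamma> - c)"
    and ab: "\<And>i. i \<in> I \<Longrightarrow> a i \<le> b i"
  shows "ennreal (\<Sum>i\<in>I. m i * (b i - a i)) \<le> weighted_length w \<gamma>"
proof -
  obtain D S where S: "finite S" "continuous_on ({0..1} - S) D"
    "\<forall>t\<in>{0..1} - S. (\<gamma> has_vector_derivative D t) (at t)"
    using valid_path_derivative[OF \<gamma>(1)] by blast
  note S = S(1,2) S(3)[rule_format]
  have c\<gamma>: "continuous_on {0..1} \<gamma>" using valid_path_imp_path[OF \<gamma>(1)] by (simp add: path_def)
  define A where "A i = {u \<in> {0..1} - S. a i \<le> cmod (\<gamma> u - c) \<and> cmod (\<gamma> u - c) \<le> b i}" for i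
  have A: "A i \<in> sets borel" for i
  proof -
    have "closed ({0..1} \<inter> (\<lambda>u. cmod (\<gamma> u - c)) -` {a i..b i})"
      by (intro continuous_closed_preimage continuous_intros c\<gamma>)
    then have "({0..1} \<inter> (\<lambda>u. cmod (\<gamma> u - c)) -` {a i..b i}) - S \<in> sets borel"
      using S(1) by (intro borel_closed_diff_finite) auto
    also have "({0..1} \<inter> (\<lambda>u. cmod (\<gamma> u - c)) -` {a i..b i}) - S = A i" by (auto simp: A_def)
    finally show ?thesis .
  qed
  have Dm: "(\<lambda>u. ennreal (cmod (D u)) * indicator (A i) u) \<in> borel_measurable lborel" for i
  proof -
    have "continuous_on (A i) D" by (rule continuous_on_subset[OF S(2)]) (auto simp: A_def)
    then have "(\<lambda>u. indicator (A i) u *\<^sub>R cmod (D u)) \<in> borel_measurable borel"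
      by (intro borel_measurable_continuous_on_indicator A continuous_intros)
    then have "(\<lambda>u. ennreal (indicator (A i) u *\<^sub>R cmod (D u))) \<in> borel_measurable borel" by simp
    also have "(\<lambda>u. ennreal (indicator (A i) u *\<^sub>R cmod (D u))) = (\<lambda>u. ennreal (cmod (D u)) * indicator (A i) u)"
      by (auto simp: indicator_def)
    finally show ?thesis by simp
  qed
  have "ennreal (\<Sum>i\<in>I. m i * (b i - a i)) = (\<Sum>i\<in>I. ennreal (m i) * ennreal (b i - a i))"
    using m ab by (subst sum_ennreal[symmetric]) (auto simp: ennreal_mult intro!: sum.cong)
  also have "\<dots> \<le> (\<Sum>i\<in>I. ennreal (m i) * (\<integral>\<^sup>+u. ennreal (cmod (D u)) * indicator (A i) u \<partial>lborel))"
  proof (rule sum_mono)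
    fix i assume i: "i \<in> I"
    have "cmod (\<gamma> 0 - c) \<le> a i" "b i \<le> cmod (\<gamma> 1 - c)" using st[OF i] fi[OF i] by (auto simp: pathstart_def pathfinish_def)
    then have "ennreal (b i - a i) \<le> (\<integral>\<^sup>+u. ennreal (cmod (D u)) * indicator (A i) u \<partial>lborel)"
      unfolding A_def by (intro annulus_crossing_length S c\<gamma>)
    then show "ennreal (m i) * ennreal (b i - a i) \<le> ennreal (m i) * (\<integral>\<^sup>+u. ennreal (cmod (D u)) * indicator (A i) u \<partial>lborel)"
      by (rule mult_left_mono) (rule zero_le)
  qed
  also have "\<dots> = (\<Sum>i\<in>I. (\<integral>\<^sup>+u. ennreal (m i) * (ennreal (cmod (D u)) * indicator (A i) u) \<partial>lborel))"
    by (intro sum.cong refl nn_integral_cmult[symmetric] Dm)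
  also have "\<dots> = (\<integral>\<^sup>+u. (\<Sum>i\<in>I. ennreal (m i) * (ennreal (cmod (D u)) * indicator (A i) u)) \<partial>lborel)"
    by (intro nn_integral_sum[symmetric] borel_measurable_times_ennreal Dm measurable_const) simp_all
  also have "\<dots> \<le> (\<integral>\<^sup>+u. ennreal (w (\<gamma> u) * cmod (D u)) * indicator ({0..1} - S) u \<partial>lborel)"
  proof (intro nn_integral_mono)
    fix u
    show "(\<Sum>i\<in>I. ennreal (m i) * (ennreal (cmod (D u)) * indicator (A i) u)) \<le> ennreal (w (\<gamma> u) * cmod (D u)) * indicator ({0..1} - S) u"
    proof (cases "\<exists>i\<in>I. u \<in> A i")
      case True
      then obtain i where i: "i \<in> I" "u \<in> A i" by blast
      have u: "u \<in> {0..1} - S" using i by (auto simp: A_def)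
      then have "\<gamma> u \<in> U" using \<gamma>(2) by (auto simp: path_image_def)
      \<comment> \<open>Disjointness leaves a single nonzero summand at each time, so the sum is
        dominated by the integrand of the length.\<close>
      have "u \<notin> A j" if "j \<in> I - {i}" for j using disj[of i j "\<gamma> u"] i that by (auto simp: A_def)
      then have "(\<Sum>i\<in>I. ennreal (m i) * (ennreal (cmod (D u)) * indicator (A i) u)) = ennreal (m i) * ennreal (cmod (D u))"
        using i I by (subst sum.remove[OF I i(1)]) (auto intro!: sum.neutral)
      also have "\<dots> = ennreal (m i * cmod (D u))" using m i by (simp add: ennreal_mult)
      also have "\<dots> \<le> ennreal (w (\<gamma> u) * cmod (D u))"
        using wm[OF i(1) \<open>\<gamma> u \<in> U\<close>] i by (intro ennreal_leI mult_right_mono) (auto simp: A_def)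
      finally show ?thesis using u by simp
    next
      case False
      then have "(\<Sum>i\<in>I. ennreal (m i) * (ennreal (cmod (D u)) * indicator (A i) u)) = 0"
        by (intro sum.neutral) auto
      then show ?thesis by simp
    qed
  qed
  also have "\<dots> = weighted_length w \<gamma>" using S by (intro weighted_length_eq[symmetric, of S \<gamma> D]) auto
  finally show ?thesis .
qed

lemma reflect_image_iff: "t \<in> (\<lambda>x. c - x) ` S \<longleftrightarrow> c - t \<in> S" for c t :: "'a::ab_group_add"
  by (auto intro: image_eqI[of _ _ "c - t"])

lemma weighted_length_reversepath:
  assumes \<gamma>: "valid_path \<gamma>" "path_image \<gamma> \<subseteq> U" and w: "continuous_on U w"
  shows "weighted_length w (reversepath \<gamma>) = weighted_length w \<gamma>"
proof -
  obtain D S where S: "finite S" "continuous_on ({0..1} - S) D"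
    "\<forall>t\<in>{0..1} - S. (\<gamma> has_vector_derivative D t) (at t)"
    using valid_path_derivative[OF \<gamma>(1)] by blast
  note S = S(1,2) S(3)[rule_format]
  have c\<gamma>: "continuous_on {0..1} \<gamma>" using valid_path_imp_path[OF \<gamma>(1)] by (simp add: path_def)
  let ?k = "\<lambda>t. ennreal (w (\<gamma> t) * cmod (D t)) * indicator ({0..1} - S) t"
  have k: "?k \<in> borel_measurable borel"
    using \<gamma>(2) by (intro weighted_length_measurable[OF S(1,2) c\<gamma> _ w]) (auto simp: path_image_def)
  have "weighted_length w (reversepath \<gamma>) =
      (\<integral>\<^sup>+t. ennreal (w (reversepath \<gamma> t) * cmod (- D (1 - t))) * indicator ({0..1} - (\<lambda>x. 1 - x) ` S) t \<partial>lborel)"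
  proof (rule weighted_length_eq)
    fix t :: real assume t: "t \<in> {0..1} - (\<lambda>x. 1 - x) ` S"
    then have "1 - t \<in> {0..1} - S" by (auto simp: reflect_image_iff)
    from S(3)[OF this] have "(\<gamma> has_vector_derivative D (1 - t)) (at ((\<lambda>x. 1 - x) t))" by simp
    moreover have "((\<lambda>x. 1 - x) has_vector_derivative (- 1)) (at t)" by (auto intro!: derivative_eq_intros)
    ultimately have "(\<gamma> \<circ> (\<lambda>x. 1 - x) has_vector_derivative (- 1) *\<^sub>R D (1 - t)) (at t)"
      by (intro vector_diff_chain_at)
    then show "(reversepath \<gamma> has_vector_derivative - D (1 - t)) (at t)" by (simp add: reversepath_def o_def)
  qed (use S in auto)
  also have "\<dots> = (\<integral>\<^sup>+t. ?k (1 + (- 1) * t) \<partial>lborel)"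
  proof (intro nn_integral_cong)
    fix t :: real
    have "t \<in> {0..1} - (\<lambda>x. 1 - x) ` S \<longleftrightarrow> 1 - t \<in> {0..1} - S"
      by (auto simp: reflect_image_iff)
    then show "ennreal (w (reversepath \<gamma> t) * cmod (- D (1 - t))) * indicator ({0..1} - (\<lambda>x. 1 - x) ` S) t = ?k (1 + (- 1) * t)"
      by (auto simp: reversepath_def indicator_def)
  qed
  also have "\<dots> = (\<integral>\<^sup>+t. ?k t \<partial>lborel)" by (subst nn_integral_real_affine[OF k, of "-1" 1]) auto
  also have "\<dots> = weighted_length w \<gamma>" using S by (intro weighted_length_eq[symmetric, of S \<gamma> D]) auto
  finally show ?thesis .
qed

lemma weighted_length_join:
  assumes g1: "valid_path g1" "path_image g1 \<subseteq> U" and g2: "valid_path g2" "path_image g2 \<subseteq> U"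
    and w: "continuous_on U w"
  shows "weighted_length w (g1 +++ g2) \<le> weighted_length w g1 + weighted_length w g2"
proof -
  obtain D1 S1 where S1: "finite S1" "continuous_on ({0..1} - S1) D1"
    "\<forall>t\<in>{0..1} - S1. (g1 has_vector_derivative D1 t) (at t)"
    using valid_path_derivative[OF g1(1)] by blast
  note S1 = S1(1,2) S1(3)[rule_format]
  obtain D2 S2 where S2: "finite S2" "continuous_on ({0..1} - S2) D2"
    "\<forall>t\<in>{0..1} - S2. (g2 has_vector_derivative D2 t) (at t)"
    using valid_path_derivative[OF g2(1)] by blast
  note S2 = S2(1,2) S2(3)[rule_format]
  have c1: "continuous_on {0..1} g1" using valid_path_imp_path[OF g1(1)] by (simp add: path_def)
  have c2: "continuous_on {0..1} g2" using valid_path_imp_path[OF g2(1)] by (simp add: path_def)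
  define k1 where "k1 t = ennreal (w (g1 t) * cmod (D1 t)) * indicator ({0..1} - S1) t" for t
  define k2 where "k2 t = ennreal (w (g2 t) * cmod (D2 t)) * indicator ({0..1} - S2) t" for t
  have k1: "k1 \<in> borel_measurable borel"
    unfolding k1_def using g1(2) by (intro weighted_length_measurable[OF S1(1,2) c1 _ w]) (simp add: path_image_def)
  have k2: "k2 \<in> borel_measurable borel"
    unfolding k2_def using g2(2) by (intro weighted_length_measurable[OF S2(1,2) c2 _ w]) (simp add: path_image_def)
  have scaled: "(\<lambda>t. k (c + 2 * t)) \<in> borel_measurable lborel" 
    "(\<integral>\<^sup>+t. 2 * k (c + 2 * t) \<partial>lborel) = (\<integral>\<^sup>+t. k t \<partial>lborel)"
    if k: "k \<in> borel_measurable borel" for k :: "real \<Rightarrow> ennreal" and c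
  proof -
    have "(\<lambda>t. c + 2 * t) \<in> borel_measurable borel" by simp
    from measurable_compose[OF this k] show m: "(\<lambda>t. k (c + 2 * t)) \<in> borel_measurable lborel" by simp
    show "(\<integral>\<^sup>+t. 2 * k (c + 2 * t) \<partial>lborel) = (\<integral>\<^sup>+t. k t \<partial>lborel)"
      using nn_integral_real_affine[OF k, of 2 c] nn_integral_cmult[OF m, of 2] by simp
  qed
  \<comment> \<open>The junction 1/2 is exceptional too, besides the rescaled break points of both
    halves.\<close>
  define S where "S = {1/2} \<union> (\<lambda>x. x / 2) ` S1 \<union> (\<lambda>x. (x + 1) / 2) ` S2"
  define D where "D t = (if t < 1/2 then 2 *\<^sub>R D1 (2 * t) else 2 *\<^sub>R D2 (2 * t - 1))" for t :: real
  have in1: "2 * t \<in> {0..1} - S1" if t: "t \<in> {0..1} - S" "t < 1/2" for t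
  proof -
    have "2 * t \<notin> S1"
    proof
      assume "2 * t \<in> S1"
      then have "2 * t / 2 \<in> (\<lambda>x. x / 2) ` S1" by (rule imageI)
      then show False using t(1) by (simp add: S_def)
    qed
    then show ?thesis using t by simp
  qed
  have in2: "2 * t - 1 \<in> {0..1} - S2" if t: "t \<in> {0..1} - S" "\<not> t < 1/2" for t
  proof -
    have "2 * t - 1 \<notin> S2"
    proof
      assume "2 * t - 1 \<in> S2"
      then have "(2 * t - 1 + 1) / 2 \<in> (\<lambda>x. (x + 1) / 2) ` S2" by (rule imageI)
      then show False using t(1) by (simp add: S_def)
    qed
    then show ?thesis using t by simp
  qed
  have "weighted_length w (g1 +++ g2) =
      (\<integral>\<^sup>+t. ennreal (w ((g1 +++ g2) t) * cmod (D t)) * indicator ({0..1} - S) t \<partial>lborel)"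
  proof (rule weighted_length_eq)
    show "finite S" using S1 S2 by (simp add: S_def)
    fix t assume t: "t \<in> {0..1} - S"
    show "(g1 +++ g2 has_vector_derivative D t) (at t)"
    proof (cases "t < 1/2")
      case True
      have "((\<lambda>x. 2 * x) has_vector_derivative 2) (at t)" by (auto intro!: derivative_eq_intros)
      then have "(g1 \<circ> (\<lambda>x. 2 * x) has_vector_derivative 2 *\<^sub>R D1 (2 * t)) (at t)"
        by (intro vector_diff_chain_at S1(3) in1 t True)
      then have "(g1 +++ g2 has_vector_derivative 2 *\<^sub>R D1 (2 * t)) (at t)"
        by (rule has_vector_derivative_transform_within_open[of _ _ _ "{..<1/2}"]) (use True in \<open>auto simp: joinpaths_def\<close>)
      then show ?thesis using True by (simp add: D_def)
    next
      case False
      then have gt: "t > 1/2" using t by (auto simp: S_def)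
      have "((\<lambda>x. 2 * x - 1) has_vector_derivative 2) (at t)" by (auto intro!: derivative_eq_intros)
      then have "(g2 \<circ> (\<lambda>x. 2 * x - 1) has_vector_derivative 2 *\<^sub>R D2 (2 * t - 1)) (at t)"
        by (intro vector_diff_chain_at S2(3) in2 t False)
      then have "(g1 +++ g2 has_vector_derivative 2 *\<^sub>R D2 (2 * t - 1)) (at t)"
        by (rule has_vector_derivative_transform_within_open[of _ _ _ "{1/2<..}"]) (use gt in \<open>auto simp: joinpaths_def\<close>)
      then show ?thesis using False by (simp add: D_def)
    qed
  qed
  also have "\<dots> \<le> (\<integral>\<^sup>+t. 2 * k1 (0 + 2 * t) + 2 * k2 (- 1 + 2 * t) \<partial>lborel)"
  proof (intro nn_integral_mono)
    fix t
    have two: "ennreal (x * (2 * y)) = 2 * ennreal (x * y)" for x y :: real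
      using ennreal_mult'[of 2 "x * y"] by (simp add: mult.left_commute)
    show "ennreal (w ((g1 +++ g2) t) * cmod (D t)) * indicator ({0..1} - S) t \<le> 2 * k1 (0 + 2 * t) + 2 * k2 (- 1 + 2 * t)"
    proof (cases "t \<in> {0..1} - S")
      case True
      show ?thesis
      proof (cases "t < 1/2")
        case lt: True
        have "ennreal (w ((g1 +++ g2) t) * cmod (D t)) * indicator ({0..1} - S) t = 2 * k1 (0 + 2 * t)"
          unfolding k1_def using True lt in1[OF True lt] by (simp add: D_def joinpaths_def two)
        then show ?thesis by simp
      next
        case ge: False
        then have "t > 1/2" using True by (auto simp: S_def)
        then have "ennreal (w ((g1 +++ g2) t) * cmod (D t)) * indicator ({0..1} - S) t = 2 * k2 (- 1 + 2 * t)"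
          unfolding k2_def using True in2[OF True ge] by (simp add: D_def joinpaths_def two)
        then show ?thesis by simp
      qed
    qed simp
  qed
  also have "\<dots> = (\<integral>\<^sup>+t. 2 * k1 (0 + 2 * t) \<partial>lborel) + (\<integral>\<^sup>+t. 2 * k2 (- 1 + 2 * t) \<partial>lborel)"
    by (intro nn_integral_add borel_measurable_times_ennreal scaled(1) k1 k2 measurable_const) simp_all
  also have "\<dots> = (\<integral>\<^sup>+t. k1 t \<partial>lborel) + (\<integral>\<^sup>+t. k2 t \<partial>lborel)"
    by (simp only: scaled(2)[OF k1] scaled(2)[OF k2])
  also have "(\<integral>\<^sup>+t. k1 t \<partial>lborel) = weighted_length w g1"
    unfolding k1_def using S1 by (intro weighted_length_eq[symmetric, of S1 g1 D1]) auto
  also have "(\<integral>\<^sup>+t. k2 t \<partial>lborel) = weighted_length w g2"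
    unfolding k2_def using S2 by (intro weighted_length_eq[symmetric, of S2 g2 D2]) auto
  finally show ?thesis .
qed

lemma weighted_length_linepath:
  assumes B: "\<And>z. z \<in> closed_segment p q \<Longrightarrow> w z \<le> B" "\<And>z. z \<in> closed_segment p q \<Longrightarrow> 0 \<le> w z"
  shows "weighted_length w (linepath p q) \<le> ennreal (B * cmod (q - p))"
proof -
  have "weighted_length w (linepath p q) \<le> (\<integral>\<^sup>+t. ennreal (B * cmod (q - p)) * indicator {0..1::real} t \<partial>lborel)"
    unfolding weighted_length_def
  proof (intro nn_integral_mono)
    fix t :: real
    show "ennreal (w (linepath p q t) * cmod (vector_derivative (linepath p q) (at t within {0..1}))) * indicator {0..1} t
       \<le> ennreal (B * cmod (q - p)) * indicator {0..1} t"
    proof (cases "t \<in> {0..1}")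
      case True
      then have "linepath p q t \<in> closed_segment p q" by (rule linepath_in_path)
      then show ?thesis using True B by (auto simp: vector_derivative_linepath_within intro!: ennreal_leI mult_right_mono)
    qed simp
  qed
  also have "\<dots> = ennreal (B * cmod (q - p))" by (simp add: nn_integral_cmult)
  finally show ?thesis .
qed

section \<open>A completeness criterion\<close>

text \<open>Complex differentiability makes the metric conformal to the Euclidean one, which reduces
  completeness to a statement about one scalar weight.\<close>

lemma sqrt_dtau2: "sqrt (dtau2 F G z v) = norm (deriv F z, deriv G z) * cmod v"
proof -
  have "dtau2 F G z v = ((cmod (deriv F z))\<^sup>2 + (cmod (deriv G z))\<^sup>2) * (cmod v)\<^sup>2"
    by (simp add: dtau2_def norm_mult power_mult_distrib distrib_right)
  then show ?thesis by (simp only: real_sqrt_mult norm_Pair real_sqrt_abs abs_norm_cancel)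
qed

lemma dtau_length_eq: "dtau_length F G = weighted_length (\<lambda>z. norm (deriv F z, deriv G z))"
  by (simp add: fun_eq_iff dtau_length_def weighted_length_def sqrt_dtau2)

definition disk_paths :: "complex \<Rightarrow> complex \<Rightarrow> (real \<Rightarrow> complex) set" where
  "disk_paths p q = {\<gamma>. valid_path \<gamma> \<and> path_image \<gamma> \<subseteq> unit_disk \<and> pathstart \<gamma> = p \<and> pathfinish \<gamma> = q}"

definition weighted_dist :: "(complex \<Rightarrow> real) \<Rightarrow> complex \<Rightarrow> complex \<Rightarrow> ennreal" where
  "weighted_dist w p q = (INF \<gamma>\<in>disk_paths p q. weighted_length w \<gamma>)"

locale conformal_weight =
  fixes w :: "complex \<Rightarrow> real"
  assumes cont: "continuous_on unit_disk w" and pos: "\<And>z. z \<in> unit_disk \<Longrightarrow> 0 < w z"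
begin

lemma weighted_dist_commute: "weighted_dist w p q = weighted_dist w q p"
proof -
  have "weighted_dist w p q \<le> weighted_dist w q p" for p q
    unfolding weighted_dist_def
  proof (rule INF_greatest)
    fix \<gamma> assume "\<gamma> \<in> disk_paths q p"
    then have "reversepath \<gamma> \<in> disk_paths p q" "weighted_length w (reversepath \<gamma>) = weighted_length w \<gamma>"
      by (auto simp: disk_paths_def valid_path_imp_reverse intro!: weighted_length_reversepath[OF _ _ cont])
    then show "(INF \<gamma>\<in>disk_paths p q. weighted_length w \<gamma>) \<le> weighted_length w \<gamma>"
      using INF_lower[of "reversepath \<gamma>" "disk_paths p q" "weighted_length w"] by simp
  qed
  then show ?thesis by (intro antisym)
qed

lemma weighted_dist_le_segment:
  assumes p: "p \<in> unit_disk" and q: "q \<in> unit_disk" and B: "\<And>z. z \<in> closed_segment p q \<Longrightarrow> w z \<le> B"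
  shows "weighted_dist w p q \<le> ennreal (B * cmod (q - p))"
proof -
  have seg: "closed_segment p q \<subseteq> unit_disk" using p q by (intro closed_segment_subset) auto
  have "0 \<le> w z" if "z \<in> closed_segment p q" for z
    using pos[OF subsetD[OF seg that]] by simp
  then have "weighted_length w (linepath p q) \<le> ennreal (B * cmod (q - p))"
    by (intro weighted_length_linepath B)
  moreover have "linepath p q \<in> disk_paths p q" using seg by (auto simp: disk_paths_def)
  ultimately show ?thesis unfolding weighted_dist_def by (intro INF_lower2)
qed

lemma weight_bounded_on_compact:
  assumes "compact S" "S \<subseteq> unit_disk"
  shows "\<exists>B. \<forall>z\<in>S. w z \<le> B"
proof -
  have "compact (w ` S)" using assms by (intro compact_continuous_image continuous_on_subset[OF cont])
  then have "bdd_above (w ` S)" by (intro bounded_imp_bdd_above compact_imp_bounded)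
  then show ?thesis unfolding bdd_above_def by blast
qed

lemma weighted_dist_finite:
  assumes p: "p \<in> unit_disk" and q: "q \<in> unit_disk"
  shows "weighted_dist w p q < \<infinity>"
proof -
  have "closed_segment p q \<subseteq> unit_disk" using p q by (intro closed_segment_subset) auto
  then obtain B where "\<And>z. z \<in> closed_segment p q \<Longrightarrow> w z \<le> B"
    using weight_bounded_on_compact[OF compact_segment] by blast
  then have "weighted_dist w p q \<le> ennreal (B * cmod (q - p))" by (rule weighted_dist_le_segment[OF p q])
  then show ?thesis by (rule le_less_trans) simp
qed

lemma weighted_dist_triangle:
  assumes "p \<in> unit_disk" "q \<in> unit_disk" "r \<in> unit_disk"
  shows "weighted_dist w p r \<le> weighted_dist w p q + weighted_dist w q r"
proof (rule ennreal_le_epsilon)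
  fix e :: real assume e: "e > 0"
  have "weighted_dist w p q < weighted_dist w p q + ennreal (e/2)"
    using weighted_dist_finite[of p q] assms e by (simp add: ennreal_add_left_cancel_less)
  then obtain g1 where g1: "g1 \<in> disk_paths p q" "weighted_length w g1 < weighted_dist w p q + ennreal (e/2)"
    unfolding weighted_dist_def INF_less_iff by blast
  have "weighted_dist w q r < weighted_dist w q r + ennreal (e/2)"
    using weighted_dist_finite[of q r] assms e by (simp add: ennreal_add_left_cancel_less)
  then obtain g2 where g2: "g2 \<in> disk_paths q r" "weighted_length w g2 < weighted_dist w q r + ennreal (e/2)"
    unfolding weighted_dist_def INF_less_iff by blast
  have "g1 +++ g2 \<in> disk_paths p r"
    using g1(1) g2(1) by (simp add: disk_paths_def valid_path_join subset_path_image_join)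
  then have "weighted_dist w p r \<le> weighted_length w (g1 +++ g2)" unfolding weighted_dist_def by (rule INF_lower)
  also have "\<dots> \<le> weighted_length w g1 + weighted_length w g2"
    using g1(1) g2(1) by (intro weighted_length_join[OF _ _ _ _ cont]) (auto simp: disk_paths_def)
  also have "\<dots> \<le> (weighted_dist w p q + ennreal (e/2)) + (weighted_dist w q r + ennreal (e/2))"
    using g1 g2 by (intro add_mono less_imp_le)
  also have "\<dots> = (weighted_dist w p q + weighted_dist w q r) + (ennreal (e/2) + ennreal (e/2))" by (simp only: ac_simps)
  also have "ennreal (e/2) + ennreal (e/2) = ennreal e" using e by (simp add: ennreal_plus[symmetric] del: ennreal_plus)
  finally show "weighted_dist w p r \<le> weighted_dist w p q + weighted_dist w q r + ennreal e" .
qed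

text \<open>A path to q must first cross a closed disk about p, and on this compact set the weight
  has a positive minimum.\<close>

lemma weighted_dist_pos:
  assumes p: "p \<in> unit_disk" and q: "q \<in> unit_disk" and ne: "p \<noteq> q"
  shows "0 < weighted_dist w p q"
proof -
  obtain e where e: "e > 0" "cball p e \<subseteq> unit_disk" using open_contains_cball_eq[OF open_ball] p by blast
  define d where "d = min e (cmod (q - p))"
  have d: "0 < d" "d \<le> cmod (q - p)" "cball p d \<subseteq> unit_disk" using e ne by (auto simp: d_def)
  have "compact (cball p d)" "cball p d \<noteq> {}" using d by auto
  then obtain z where z: "z \<in> cball p d" "\<forall>y\<in>cball p d. w z \<le> w y"
    using continuous_attains_inf[of "cball p d" w] continuous_on_subset[OF cont d(3)] by blast
  have "w z > 0" using z d pos by auto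
  have "ennreal (w z * d) \<le> weighted_dist w p q"
    unfolding weighted_dist_def
  proof (rule INF_greatest)
    fix \<gamma> assume "\<gamma> \<in> disk_paths p q"
    then have \<gamma>: "valid_path \<gamma>" "path_image \<gamma> \<subseteq> unit_disk" "pathstart \<gamma> = p" "pathfinish \<gamma> = q" by (auto simp: disk_paths_def)
    have "ennreal (\<Sum>i\<in>{()}. w z * (d - 0)) \<le> weighted_length w \<gamma>"
    proof (rule weighted_length_ge_annuli[OF \<gamma>(1,2) cont, where c = p and a = "\<lambda>_. 0" and b = "\<lambda>_. d"])
      show "w z \<le> w y" if "cmod (y - p) \<le> d" for y using that z by (auto simp: dist_norm norm_minus_commute)
      show "0 \<le> w y" if "y \<in> unit_disk" for y using pos[OF that] by simp
    qed (use d \<gamma> \<open>w z > 0\<close> in auto)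
    then show "ennreal (w z * d) \<le> weighted_length w \<gamma>" by simp
  qed
  moreover have "0 < ennreal (w z * d)" using \<open>w z > 0\<close> d by simp
  ultimately show ?thesis by (rule less_le_trans[rotated])
qed

lemma Metric_space_weighted_dist: "Metric_space unit_disk (\<lambda>p q. enn2real (weighted_dist w p q))"
proof
  show "0 \<le> enn2real (weighted_dist w p q)" for p q by simp
  show "enn2real (weighted_dist w p q) = enn2real (weighted_dist w q p)" for p q
    by (simp only: weighted_dist_commute[of p q])
  fix p q assume p: "p \<in> unit_disk" and q: "q \<in> unit_disk"
  have "weighted_dist w p p = 0" using weighted_dist_le_segment[OF p p, of "w p"] by simp
  then show "(enn2real (weighted_dist w p q) = 0) = (p = q)"
    using weighted_dist_pos[OF p q] weighted_dist_finite[OF p q]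
    by (cases "p = q") (auto simp: enn2real_eq_0_iff)
  fix r assume r: "r \<in> unit_disk"
  have "enn2real (weighted_dist w p r) \<le> enn2real (weighted_dist w p q + weighted_dist w q r)"
    using weighted_dist_finite[OF p q] weighted_dist_finite[OF q r]
    by (intro enn2real_mono weighted_dist_triangle p q r) (auto simp: ennreal_add_eq_top less_top)
  also have "\<dots> = enn2real (weighted_dist w p q) + enn2real (weighted_dist w q r)"
    using weighted_dist_finite[OF p q] weighted_dist_finite[OF q r] by (intro enn2real_plus) (auto simp: less_top)
  finally show "enn2real (weighted_dist w p r) \<le> enn2real (weighted_dist w p q) + enn2real (weighted_dist w q r)" .
qed

text \<open>A Hopf-Rinow argument: going outwards through annuli costs at least the corresponding
  partial sum, so divergence traps the tail of a Cauchy sequence in a compact disk, where Euclidean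
  compactness supplies a limit.\<close>

lemma mcomplete_weighted_dist:
  assumes ab: "\<And>n. 0 < a n" "\<And>n. a n < b n" "\<And>n. b n < a (Suc n)" "\<And>n. b n < 1"
    and a1: "a \<longlonglongrightarrow> 1"
    and m: "\<And>n. 0 \<le> m n" "\<And>n z. a n \<le> cmod z \<Longrightarrow> cmod z \<le> b n \<Longrightarrow> m n \<le> w z"
    and div: "\<not> summable (\<lambda>n. m n * (b n - a n))"
  shows "Metric_space.mcomplete unit_disk (\<lambda>p q. enn2real (weighted_dist w p q))"
proof -
  interpret Metric_space unit_disk "\<lambda>p q. enn2real (weighted_dist w p q)" by (rule Metric_space_weighted_dist)
  have "a n < a (Suc n)" for n using ab(2,3)[of n] by simp
  then have amono: "mono a" by (intro incseq_SucI less_imp_le)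
  have blt: "b i < a j" if "i < j" for i j
    using ab(3)[of i] monoD[OF amono, of "Suc i" j] that by simp
  show ?thesis unfolding mcomplete_def
  proof (intro allI impI)
    fix \<sigma> assume C: "MCauchy \<sigma>"
    then have ran: "range \<sigma> \<subseteq> unit_disk"
      unfolding MCauchy_def by (rule conjunct1)
    from C have cau: "\<forall>\<epsilon>>0. \<exists>N. \<forall>n n'. N \<le> n \<longrightarrow> N \<le> n' \<longrightarrow> enn2real (weighted_dist w (\<sigma> n) (\<sigma> n')) < \<epsilon>"
      unfolding MCauchy_def by (rule conjunct2)
    have \<sigma>: "\<sigma> n \<in> unit_disk" for n using ran by (rule subsetD) (rule rangeI)
    obtain N where "\<forall>n n'. N \<le> n \<longrightarrow> N \<le> n' \<longrightarrow> enn2real (weighted_dist w (\<sigma> n) (\<sigma> n')) < 1"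
      using cau zero_less_one by blast
    then have N: "enn2real (weighted_dist w (\<sigma> N) (\<sigma> n)) < 1" if "n \<ge> N" for n using that by simp
    have "\<forall>\<^sub>F k in sequentially. cmod (\<sigma> N) < a k" using \<sigma>[of N] by (intro order_tendstoD[OF a1]) auto
    then obtain k0 where k0: "cmod (\<sigma> N) < a k0" by (auto simp: eventually_sequentially)
    \<comment> \<open>Only annuli outside |\<open>\<sigma> N\<close>| are counted. Finitely many of
      them already cost more than 1, the distance within which the tail stays from
      \<open>\<sigma> N\<close>.\<close>
    have "\<exists>k. (\<Sum>i<k. m (i + k0) * (b (i + k0) - a (i + k0))) > 1"
    proof (rule ccontr)
      assume "\<not> ?thesis"
      then have "(\<Sum>i<k. m (i + k0) * (b (i + k0) - a (i + k0))) \<le> 1" for k by (simp add: not_less)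
      then have "summable (\<lambda>i. m (i + k0) * (b (i + k0) - a (i + k0)))"
        by (intro summableI_nonneg_bounded[of _ 1] mult_nonneg_nonneg m(1)) (simp add: less_imp_le[OF ab(2)])
      then show False using div summable_iff_shift[of "\<lambda>n. m n * (b n - a n)" k0] by simp
    qed
    then obtain k where k: "(\<Sum>i<k. m (i + k0) * (b (i + k0) - a (i + k0))) > 1" by blast
    have bound: "cmod (\<sigma> n) \<le> b (k + k0)" if n: "n \<ge> N" for n
    proof (rule ccontr)
      assume "\<not> cmod (\<sigma> n) \<le> b (k + k0)"
      then have gt: "b (k + k0) < cmod (\<sigma> n)" by simp
      have "ennreal 1 \<le> weighted_dist w (\<sigma> N) (\<sigma> n)"
        unfolding weighted_dist_def
      proof (rule INF_greatest)
        fix \<gamma> assume "\<gamma> \<in> disk_paths (\<sigma> N) (\<sigma> n)"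
        then have \<gamma>: "valid_path \<gamma>" "path_image \<gamma> \<subseteq> unit_disk" "pathstart \<gamma> = \<sigma> N" "pathfinish \<gamma> = \<sigma> n"
          by (auto simp: disk_paths_def)
        have "ennreal 1 \<le> ennreal (\<Sum>i<k. m (i + k0) * (b (i + k0) - a (i + k0)))" using k by (intro ennreal_leI) simp
        also have "\<dots> \<le> weighted_length w \<gamma>"
        proof (rule weighted_length_ge_annuli[OF \<gamma>(1,2) cont, where c = 0])
          fix i assume i: "i \<in> {..<k}"
          show "cmod (pathstart \<gamma> - 0) \<le> a (i + k0)" using k0 monoD[OF amono, of k0 "i + k0"] \<gamma> by simp
          show "b (i + k0) \<le> cmod (pathfinish \<gamma> - 0)"
            using blt[of "i + k0" "k + k0"] ab(2)[of "k + k0"] i gt \<gamma> by simp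
          fix j and z :: complex
          assume "j \<in> {..<k}" "a (i + k0) \<le> cmod (z - 0)" "cmod (z - 0) \<le> b (i + k0)" "a (j + k0) \<le> cmod (z - 0)" "cmod (z - 0) \<le> b (j + k0)"
          then have "\<not> i < j" "\<not> j < i" using blt[of "i + k0" "j + k0"] blt[of "j + k0" "i + k0"] by auto
          then show "i = j" by simp
        next
          show "0 \<le> w z" if "z \<in> unit_disk" for z using pos[OF that] by simp
          show "m (i + k0) \<le> w z" if "a (i + k0) \<le> cmod (z - 0)" "cmod (z - 0) \<le> b (i + k0)" for i z
            using m(2)[of "i + k0" z] that by simp
          show "0 \<le> m (i + k0)" for i by (rule m(1))
          show "a (i + k0) \<le> b (i + k0)" for i using ab(2)[of "i + k0"] by simp
        qed simp
        finally show "ennreal 1 \<le> weighted_length w \<gamma>" .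
      qed
      then have "1 \<le> enn2real (weighted_dist w (\<sigma> N) (\<sigma> n))"
        using enn2real_mono[of "ennreal 1"] weighted_dist_finite[OF \<sigma>[of N] \<sigma>[of n]] by simp
      with N[OF n] show False by simp
    qed
    define \<rho> where "\<rho> = b (k + k0)"
    have \<rho>: "\<rho> < 1" "cball 0 \<rho> \<subseteq> unit_disk" using ab(4)[of "k + k0"] by (auto simp: \<rho>_def)
    obtain B where B: "\<And>z. z \<in> cball 0 \<rho> \<Longrightarrow> w z \<le> B"
      using weight_bounded_on_compact[OF compact_cball \<rho>(2)] by blast
    have "seq_compact (cball 0 \<rho> :: complex set)" by (simp add: compact_imp_seq_compact)
    moreover have "\<forall>n. \<sigma> (n + N) \<in> cball 0 \<rho>" using bound by (auto simp: \<rho>_def)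
    ultimately obtain l s where l: "l \<in> cball 0 \<rho>" and s: "strict_mono s" "((\<lambda>n. \<sigma> (n + N)) \<circ> s) \<longlonglongrightarrow> l"
      by (rule seq_compactE)
    define r where "r n = s n + N" for n
    have r: "strict_mono r" using s(1) by (auto simp: r_def strict_mono_def)
    have lim: "(\<lambda>n. \<sigma> (r n)) \<longlonglongrightarrow> l" using s(2) by (simp add: o_def r_def)
    have "limitin mtopology (\<sigma> \<circ> r) l sequentially"
      unfolding limitin_metric_dist_null
    proof (intro conjI)
      show "l \<in> unit_disk" using l \<rho> by auto
      show "\<forall>\<^sub>F n in sequentially. (\<sigma> \<circ> r) n \<in> unit_disk" using \<sigma> by (simp del: mem_ball)
      \<comment> \<open>Convergence is needed in the weighted metric, not the Euclidean one; on the
        convex compact disk the weight is bounded, so straight segments compare the two.\<close>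
      have le: "enn2real (weighted_dist w (\<sigma> (r n)) l) \<le> \<bar>B\<bar> * cmod (l - \<sigma> (r n))" for n
      proof -
        have seg: "closed_segment (\<sigma> (r n)) l \<subseteq> cball 0 \<rho>"
          using l bound[of "r n"] by (intro closed_segment_subset) (auto simp: r_def \<rho>_def)
        have "w z \<le> \<bar>B\<bar>" if "z \<in> closed_segment (\<sigma> (r n)) l" for z
          using B[OF subsetD[OF seg that]] by simp
        then have "weighted_dist w (\<sigma> (r n)) l \<le> ennreal (\<bar>B\<bar> * cmod (l - \<sigma> (r n)))"
          by (intro weighted_dist_le_segment \<sigma> \<open>l \<in> unit_disk\<close>)
        then have "enn2real (weighted_dist w (\<sigma> (r n)) l) \<le> enn2real (ennreal (\<bar>B\<bar> * cmod (l - \<sigma> (r n))))"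
          by (intro enn2real_mono) auto
        then show ?thesis by simp
      qed
      have "(\<lambda>n. \<bar>B\<bar> * cmod (l - \<sigma> (r n))) \<longlonglongrightarrow> \<bar>B\<bar> * cmod (l - l)" by (intro tendsto_intros lim)
      then have lim0: "(\<lambda>n. \<bar>B\<bar> * cmod (l - \<sigma> (r n))) \<longlonglongrightarrow> 0" by simp
      show "(\<lambda>n. enn2real (weighted_dist w ((\<sigma> \<circ> r) n) l)) \<longlonglongrightarrow> 0"
        by (rule tendsto_sandwich[OF _ _ tendsto_const lim0]) (auto simp: le)
    qed
    then show "\<exists>x. limitin mtopology \<sigma> x sequentially"
      using MCauchy_convergent_subsequence[OF C r] by blast
  qed
qed

end

lemma weakly_complete_criterion:
  assumes "F holomorphic_on unit_disk" "G holomorphic_on unit_disk" "dtau2_pos_def F G"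
    and ab: "\<And>n. 0 < a n" "\<And>n. a n < b n" "\<And>n. b n < a (Suc n)" "\<And>n. b n < 1"
    and a1: "a \<longlonglongrightarrow> 1"
    and m: "\<And>n. 0 \<le> m n" "\<And>n z. a n \<le> cmod z \<Longrightarrow> cmod z \<le> b n \<Longrightarrow> m n \<le> norm (deriv F z, deriv G z)"
    and div: "\<not> summable (\<lambda>n. m n * (b n - a n))"
  shows "weakly_complete F G"
proof -
  interpret conformal_weight "\<lambda>z. norm (deriv F z, deriv G z)"
  proof
    show "continuous_on unit_disk (\<lambda>z. norm (deriv F z, deriv G z))"
      using assms(1,2) by (intro continuous_intros holomorphic_on_imp_continuous_on holomorphic_deriv) auto
    fix z assume "z \<in> unit_disk"
    then have "0 < dtau2 F G z 1" using assms(3) by (simp add: dtau2_pos_def_def)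
    then have "0 < sqrt (dtau2 F G z 1)" by simp
    then show "0 < norm (deriv F z, deriv G z)" unfolding sqrt_dtau2 by simp
  qed
  have "dtau_dist F G = (\<lambda>p q. enn2real (weighted_dist (\<lambda>z. norm (deriv F z, deriv G z)) p q))"
    by (simp add: fun_eq_iff dtau_dist_def weighted_dist_def disk_paths_def dtau_length_eq)
  then show ?thesis unfolding weakly_complete_def using mcomplete_weighted_dist[OF ab a1 m div] by simp
qed

section \<open>Construction of the front\<close>

lemma bounded_contact_disk:
  obtains F G K :: "complex \<Rightarrow> complex" and a b m :: "nat \<Rightarrow> real" where
    "F holomorphic_on unit_disk" "G holomorphic_on unit_disk" "K holomorphic_on unit_disk"
    "\<And>z. z \<in> unit_disk \<Longrightarrow> deriv K z = (F z * deriv G z - G z * deriv F z) / 2"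
    "\<And>z. z \<in> unit_disk \<Longrightarrow> cmod (F z) \<le> 3" "\<And>z. z \<in> unit_disk \<Longrightarrow> cmod (G z) \<le> 3"
    "\<And>z. z \<in> unit_disk \<Longrightarrow> cmod (K z) \<le> 2"
    "\<And>n. 0 < a n" "\<And>n. a n < b n" "\<And>n. b n < a (Suc n)" "\<And>n. b n < 1" "a \<longlonglongrightarrow> 1"
    "\<And>n. real n \<le> m n" "\<And>n. m n * (b n - a n) = 1 / (32000 * (real n + 2))"
    "\<And>n z. a n \<le> cmod z \<Longrightarrow> cmod z \<le> b n \<Longrightarrow> m n - 1 \<le> norm (deriv F z, deriv G z)"
proof -
  obtain p q k :: "nat \<Rightarrow> complex poly" and r a m :: "nat \<Rightarrow> real" where
    con: "\<And>n. contact_poly (p n) (q n) (k n)"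
    and g: "\<And>n z. cmod z = 1 \<Longrightarrow> gauge (poly (p n) z) (poly (q n) z) (poly (k n) z) \<le> 3/2"
    and st: "\<And>n z. cmod z \<le> r n \<Longrightarrow> cmod (poly (p (Suc n)) z - poly (p n) z) \<le> tolerance n \<and>
       cmod (poly (q (Suc n)) z - poly (q n) z) \<le> tolerance n \<and> cmod (poly (k (Suc n)) z - poly (k n) z) \<le> tolerance n \<and>
       cmod (poly (pderiv (p (Suc n))) z - poly (pderiv (p n)) z) \<le> tolerance n \<and>
       cmod (poly (pderiv (q (Suc n))) z - poly (pderiv (q n)) z) \<le> tolerance n"
    and r: "\<And>n. 0 \<le> r n" "\<And>n. r n < a n" "\<And>n. a n < r (Suc n)" "\<And>n. r n < 1" "\<And>n. 1 - 1 / real (Suc n) < a n"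
    and m: "\<And>n. real n \<le> m n" "\<And>n. m n * (r (Suc n) - a n) = 1 / (32000 * (real n + 2))"
    and low: "\<And>n z. a n \<le> cmod z \<Longrightarrow> cmod z \<le> r (Suc n) \<Longrightarrow>
       m n \<le> norm (poly (pderiv (p (Suc n))) z, poly (pderiv (q (Suc n))) z)"
    using contact_sequence by metis
  have rS1: "r n < r (Suc n)" for n using r(2,3)[of n] by simp
  then have inc: "incseq r" by (intro incseq_SucI less_imp_le)
  have "(\<lambda>n. 1 - 1 / real (Suc n)) \<longlonglongrightarrow> 1 - 0"
    using LIMSEQ_Suc[OF lim_const_over_n[of "1::real"]] by (intro tendsto_intros) simp
  then have l1: "(\<lambda>n. 1 - 1 / real (Suc n)) \<longlonglongrightarrow> 1" by simp
  have a_le: "1 - 1 / real (Suc n) \<le> a n" "a n \<le> r (Suc n)" "1 - 1 / real (Suc n) \<le> r (Suc n)" "r (Suc n) \<le> 1" for n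
    using r(3,5)[of n] r(4)[of "Suc n"] by linarith+
  have rS: "(\<lambda>n. r (Suc n)) \<longlonglongrightarrow> 1"
    by (rule tendsto_sandwich[OF always_eventually always_eventually l1 tendsto_const]) (rule allI a_le)+
  then have r1: "r \<longlonglongrightarrow> 1" by (simp only: filterlim_sequentially_Suc)
  have a1: "a \<longlonglongrightarrow> 1"
    by (rule tendsto_sandwich[OF always_eventually always_eventually l1 rS]) (rule allI a_le)+
  have sm: "summable tolerance" using tolerance_sums by (rule sums_summable)
  obtain F where F: "F holomorphic_on unit_disk" "\<And>z. z \<in> unit_disk \<Longrightarrow> (\<lambda>n. poly (p n) z) \<longlonglongrightarrow> F z"
    "\<And>z. z \<in> unit_disk \<Longrightarrow> (\<lambda>n. poly (pderiv (p n)) z) \<longlonglongrightarrow> deriv F z"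
    using poly_sequence_limit[OF inc r1 r(4) sm, of p] st by metis
  obtain G where G: "G holomorphic_on unit_disk" "\<And>z. z \<in> unit_disk \<Longrightarrow> (\<lambda>n. poly (q n) z) \<longlonglongrightarrow> G z"
    "\<And>z. z \<in> unit_disk \<Longrightarrow> (\<lambda>n. poly (pderiv (q n)) z) \<longlonglongrightarrow> deriv G z"
    using poly_sequence_limit[OF inc r1 r(4) sm, of q] st by metis
  obtain K where K: "K holomorphic_on unit_disk" "\<And>z. z \<in> unit_disk \<Longrightarrow> (\<lambda>n. poly (k n) z) \<longlonglongrightarrow> K z"
    "\<And>z. z \<in> unit_disk \<Longrightarrow> (\<lambda>n. poly (pderiv (k n)) z) \<longlonglongrightarrow> deriv K z"
    using poly_sequence_limit[OF inc r1 r(4) sm, of k] st by metis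
  \<comment> \<open>The gauge bound gives |F|^2 + |G|^2 at most 17/4 on the circle; the maximum
    modulus principle later moves the three separate bounds inside.\<close>
  have circle: "cmod (poly (p n) z) \<le> 3" "cmod (poly (q n) z) \<le> 3" "cmod (poly (k n) z) \<le> 2" if z: "cmod z = 1" for n z
  proof -
    have sq: "(cmod (poly (p n) z))\<^sup>2 + (cmod (poly (q n) z))\<^sup>2 \<le> 3 + 5/4"
      using gauge_bounds(1)[OF g[OF z, of n]] by linarith
    have "(cmod (poly (p n) z))\<^sup>2 \<le> 9" using sq zero_le_power2[of "cmod (poly (q n) z)"] by linarith
    then have "(cmod (poly (p n) z))\<^sup>2 \<le> 3\<^sup>2" by simp
    then show "cmod (poly (p n) z) \<le> 3" by (rule power2_le_imp_le) simp
    have "(cmod (poly (q n) z))\<^sup>2 \<le> 9" using sq zero_le_power2[of "cmod (poly (p n) z)"] by linarith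
    then have "(cmod (poly (q n) z))\<^sup>2 \<le> 3\<^sup>2" by simp
    then show "cmod (poly (q n) z) \<le> 3" by (rule power2_le_imp_le) simp
    show "cmod (poly (k n) z) \<le> 2" using gauge_bounds(2)[OF g[OF z, of n]] by simp
  qed
  show ?thesis
  proof (rule that[of F G K a "\<lambda>n. r (Suc n)" m])
    fix z assume z: "z \<in> unit_disk"
    have z1: "cmod z \<le> 1" using z by simp
    have "poly (pderiv (k n)) z = (poly (p n) z * poly (pderiv (q n)) z - poly (q n) z * poly (pderiv (p n)) z) / 2" for n
      using con[of n] by (simp add: contact_poly_def)
    then have "(\<lambda>n. poly (pderiv (k n)) z) \<longlonglongrightarrow> (F z * deriv G z - G z * deriv F z) / 2"
      by (simp only:) (intro tendsto_intros F G z, simp)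
    with K(3)[OF z] show "deriv K z = (F z * deriv G z - G z * deriv F z) / 2" by (rule LIMSEQ_unique)
    show "cmod (F z) \<le> 3"
      using poly_bounded_by_circle[OF circle(1) z1] by (intro LIMSEQ_le_const2[OF tendsto_norm[OF F(2)[OF z]]]) blast
    show "cmod (G z) \<le> 3"
      using poly_bounded_by_circle[OF circle(2) z1] by (intro LIMSEQ_le_const2[OF tendsto_norm[OF G(2)[OF z]]]) blast
    show "cmod (K z) \<le> 2"
      using poly_bounded_by_circle[OF circle(3) z1] by (intro LIMSEQ_le_const2[OF tendsto_norm[OF K(2)[OF z]]]) blast
  next
    fix n z assume z: "a n \<le> cmod z" "cmod z \<le> r (Suc n)"
    have zd: "z \<in> unit_disk" using z r(4)[of "Suc n"] by simp
    \<comment> \<open>The annulus is protected from stage \<open>Suc n\<close> on. The derivatives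
      of \<open>F\<close> and \<open>G\<close> therefore each move by at most the sum 1/8 of all
      tolerances, well within the loss of 1 in \<open>m n - 1\<close>.\<close>
    have zj: "cmod z \<le> r j" if "j \<ge> Suc n" for j using z incseqD[OF inc that] by linarith
    have dF: "cmod (deriv F z - poly (pderiv (p (Suc n))) z) \<le> suminf tolerance"
      using st zj by (intro tendsto_dist_le_suminf[OF F(3)[OF zd] sm less_imp_le[OF tolerance_pos]]) blast
    have dG: "cmod (deriv G z - poly (pderiv (q (Suc n))) z) \<le> suminf tolerance"
      using st zj by (intro tendsto_dist_le_suminf[OF G(3)[OF zd] sm less_imp_le[OF tolerance_pos]]) blast
    define X where "X = (poly (pderiv (p (Suc n))) z, poly (pderiv (q (Suc n))) z)"
    have "norm ((deriv F z, deriv G z) - X) \<le> 1/8 + 1/8"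
      using norm_Pair_le[of "deriv F z - poly (pderiv (p (Suc n))) z" "deriv G z - poly (pderiv (q (Suc n))) z"] dF dG
      unfolding sums_unique[OF tolerance_sums, symmetric] X_def by simp
    moreover have "norm X \<le> norm (deriv F z, deriv G z) + norm (X - (deriv F z, deriv G z))" by (rule norm_triangle_sub)
    moreover have "m n \<le> norm X" using low[OF z] by (simp add: X_def)
    ultimately show "m n - 1 \<le> norm (deriv F z, deriv G z)" by (simp add: norm_minus_commute)
  next
    show "0 < a n" for n using r(1,2)[of n] by linarith
  qed (use F G K r m a1 in auto)
qed

section \<open>Removal of common zeros, and density of the regular points\<close>

lemma fsigma_unit_disk: "fsigma unit_disk"
proof -
  have "fsigma (\<Union>n. cball (0 :: complex) (1 - inverse (real (Suc n))))" by (rule fsigma.intros) simp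
  also have "(\<Union>n. cball (0 :: complex) (1 - inverse (real (Suc n)))) = unit_disk"
  proof (intro equalityI subsetI)
    fix z :: complex assume "z \<in> unit_disk"
    then have "0 < 1 - cmod z" by simp
    then obtain n where "inverse (real (Suc n)) < 1 - cmod z" using reals_Archimedean by blast
    then have "z \<in> cball 0 (1 - inverse (real (Suc n)))" by simp
    then show "z \<in> (\<Union>n. cball 0 (1 - inverse (real (Suc n))))" by blast
  next
    fix z :: complex assume "z \<in> (\<Union>n. cball 0 (1 - inverse (real (Suc n))))"
    then obtain n where "cmod z \<le> 1 - inverse (real (Suc n))" by auto
    moreover have "0 < inverse (real (Suc n))" by simp
    ultimately have "cmod z < 1" by linarith
    then show "z \<in> unit_disk" by simp
  qed
  finally show ?thesis .
qed

text \<open>Applied to F' and G'. The choice of \<open>\<beta>\<close> normalises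
  \<open>q 0 + \<beta>\<close> to 1. The zeros of \<open>q + \<beta>\<close> are then countable, so
  \<open>\<alpha>\<close> has only countably many values to avoid and can be found in the unit disk
  about \<open>- p 0\<close>, which also gives the strict inequality at the origin.\<close>

lemma common_zero_avoidance:
  fixes p q :: "complex \<Rightarrow> complex"
  assumes p: "p holomorphic_on unit_disk" and q: "q holomorphic_on unit_disk"
  obtains \<alpha> \<beta> where "cmod (p 0 + \<alpha>) < cmod (q 0 + \<beta>)"
    "\<And>z. z \<in> unit_disk \<Longrightarrow> p z + \<alpha> \<noteq> 0 \<or> q z + \<beta> \<noteq> 0"
proof -
  define \<beta> where "\<beta> = 1 - q 0"
  have "countable {z \<in> unit_disk. q z + \<beta> = 0}"
  proof (cases "(\<lambda>z. q z + \<beta>) constant_on unit_disk")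
    \<comment> \<open>If \<open>q + \<beta>\<close> is constant, the constant is its value 1 at the
      origin, so there are no zeros.\<close>
    case True
    then obtain y where y: "\<And>z. z \<in> unit_disk \<Longrightarrow> q z + \<beta> = y" unfolding constant_on_def by blast
    have "q z + \<beta> = 1" if "z \<in> unit_disk" for z using y[OF that] y[of 0] by (simp add: \<beta>_def)
    then have "{z \<in> unit_disk. q z + \<beta> = 0} = {}" by auto
    then show ?thesis by (simp only: countable_empty)
  next
    case False
    show ?thesis
      by (rule holomorphic_countable_zeros[OF _ _ _ fsigma_unit_disk False]) (intro holomorphic_intros q, simp_all)
  qed
  then have "countable ((\<lambda>z. - p z) ` {z \<in> unit_disk. q z + \<beta> = 0})" by (rule countable_image)
  then have "\<not> ball (- p 0) 1 \<subseteq> (\<lambda>z. - p z) ` {z \<in> unit_disk. q z + \<beta> = 0}"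
    using uncountable_ball[of 1 "- p 0"] countable_subset by auto
  then obtain \<alpha> where \<alpha>: "\<alpha> \<in> ball (- p 0) 1" "\<alpha> \<notin> (\<lambda>z. - p z) ` {z \<in> unit_disk. q z + \<beta> = 0}" by blast
  show ?thesis
  proof (rule that[of \<alpha> \<beta>])
    have "cmod (- p 0 - \<alpha>) < 1" using \<alpha>(1) by (simp add: dist_norm)
    moreover have "- p 0 - \<alpha> = - (p 0 + \<alpha>)" by simp
    then have "cmod (- p 0 - \<alpha>) = cmod (p 0 + \<alpha>)" by (simp only: norm_minus_cancel)
    ultimately show "cmod (p 0 + \<alpha>) < cmod (q 0 + \<beta>)" by (simp add: \<beta>_def)
    show "p z + \<alpha> \<noteq> 0 \<or> q z + \<beta> \<noteq> 0" if z: "z \<in> unit_disk" for z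
    proof (rule ccontr)
      assume "\<not> ?thesis"
      then have "q z + \<beta> = 0" "\<alpha> = - p z" by (auto simp: eq_neg_iff_add_eq_0 add.commute)
      then show False using \<alpha>(2) z by blast
    qed
  qed
qed

lemma open_nonsingular:
  assumes F: "F holomorphic_on unit_disk" and G: "G holomorphic_on unit_disk"
    and nz: "\<And>z. z \<in> unit_disk \<Longrightarrow> deriv F z \<noteq> 0 \<or> deriv G z \<noteq> 0"
  shows "unit_disk - singular_set F G = {z \<in> unit_disk. cmod (deriv F z) \<noteq> cmod (deriv G z)}"
    and "open (unit_disk - singular_set F G)"
proof -
  \<comment> \<open>Where F' vanishes, \<open>rho\<close> is 0 by convention while G' is nonzero, so
    both sides are false.\<close>
  have iff: "cmod (rho F G z) = 1 \<longleftrightarrow> cmod (deriv F z) = cmod (deriv G z)" if "z \<in> unit_disk" for z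
    using nz[OF that] by (auto simp: rho_def norm_divide)
  then show eq: "unit_disk - singular_set F G = {z \<in> unit_disk. cmod (deriv F z) \<noteq> cmod (deriv G z)}"
    unfolding singular_set_def by blast
  have "continuous_on unit_disk (\<lambda>z. cmod (deriv F z) - cmod (deriv G z))"
    using F G by (intro continuous_intros holomorphic_on_imp_continuous_on holomorphic_deriv) auto
  then have "open (unit_disk \<inter> (\<lambda>z. cmod (deriv F z) - cmod (deriv G z)) -` (- {0}))"
    by (rule continuous_open_preimage) auto
  also have "unit_disk \<inter> (\<lambda>z. cmod (deriv F z) - cmod (deriv G z)) -` (- {0}) = {z \<in> unit_disk. cmod (deriv F z) \<noteq> cmod (deriv G z)}"
    by auto
  finally show "open (unit_disk - singular_set F G)" unfolding eq .
qed

text \<open>If \<open>|F'| = |G'|\<close> on a disk, then \<open>G'/F'\<close> is a unimodular constant there, hence everywhere.\<close>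

lemma dense_nonsingular:
  assumes F: "F holomorphic_on unit_disk" and G: "G holomorphic_on unit_disk"
    and nz: "\<And>z. z \<in> unit_disk \<Longrightarrow> deriv F z \<noteq> 0 \<or> deriv G z \<noteq> 0"
    and ne: "cmod (deriv F 0) \<noteq> cmod (deriv G 0)"
  shows "unit_disk \<subseteq> closure (unit_disk - singular_set F G)"
proof
  fix z0 assume z0: "z0 \<in> unit_disk"
  show "z0 \<in> closure (unit_disk - singular_set F G)"
  proof (rule ccontr)
    assume "z0 \<notin> closure (unit_disk - singular_set F G)"
    then have "z0 \<in> unit_disk - closure (unit_disk - singular_set F G)" using z0 by blast
    moreover have "open (unit_disk - closure (unit_disk - singular_set F G))" by (intro open_Diff) auto
    ultimately obtain e where e: "e > 0" "ball z0 e \<subseteq> unit_disk - closure (unit_disk - singular_set F G)"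
      using open_contains_ball_eq by blast
    have sub: "ball z0 e \<subseteq> unit_disk" using e(2) by blast
    have ns: "unit_disk - singular_set F G = {z \<in> unit_disk. cmod (deriv F z) \<noteq> cmod (deriv G z)}"
      by (rule open_nonsingular(1)[OF F G nz])
    have eq: "cmod (deriv F z) = cmod (deriv G z)" if z: "z \<in> ball z0 e" for z
    proof (rule ccontr)
      assume "cmod (deriv F z) \<noteq> cmod (deriv G z)"
      then have "z \<in> unit_disk - singular_set F G" unfolding ns using subsetD[OF sub z] by simp
      then have "z \<in> closure (unit_disk - singular_set F G)" by (rule subsetD[OF closure_subset])
      then show False using subsetD[OF e(2) z] by simp
    qed
    have Fnz: "deriv F z \<noteq> 0" if z: "z \<in> ball z0 e" for z
    proof
      assume "deriv F z = 0"
      then have "deriv G z = 0" using eq[OF z] by simp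
      with \<open>deriv F z = 0\<close> nz[OF subsetD[OF sub z]] show False by simp
    qed
    have dF: "deriv F holomorphic_on unit_disk" and dG: "deriv G holomorphic_on unit_disk"
      by (rule holomorphic_deriv[OF F open_ball], rule holomorphic_deriv[OF G open_ball])
    have "(\<lambda>z. deriv G z / deriv F z) constant_on ball z0 e"
    \<comment> \<open>The quotient has modulus 1 throughout, so the centre is trivially a
      maximum.\<close>
    proof (rule maximum_modulus_principle[where U = "ball z0 e" and \<xi> = z0])
      show "(\<lambda>z. deriv G z / deriv F z) holomorphic_on ball z0 e"
        by (intro holomorphic_on_divide holomorphic_on_subset[OF dF sub] holomorphic_on_subset[OF dG sub] Fnz)
      fix z assume z: "z \<in> ball z0 e"
      have "cmod (deriv G z / deriv F z) = 1" if "z \<in> ball z0 e" for z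
        using Fnz[OF that] by (simp add: norm_divide eq[OF that, symmetric])
      then show "cmod (deriv G z / deriv F z) \<le> cmod (deriv G z0 / deriv F z0)" using z e(1) by simp
    qed (use e(1) in auto)
    then obtain c where c: "\<And>z. z \<in> ball z0 e \<Longrightarrow> deriv G z / deriv F z = c" unfolding constant_on_def by blast
    then have Gc: "deriv G z = c * deriv F z" if "z \<in> ball z0 e" for z
      using c[OF that] Fnz[OF that] by (simp add: divide_eq_eq)
    have z0e: "z0 \<in> ball z0 e" using e(1) by simp
    have "cmod c = 1"
      unfolding c[OF z0e, symmetric] using Fnz[OF z0e] by (simp add: norm_divide eq[OF z0e, symmetric])
    have "deriv G 0 - c * deriv F 0 = 0"
    proof (rule analytic_continuation[where f = "\<lambda>z. deriv G z - c * deriv F z" and U = "ball z0 e" and \<xi> = z0 and S = unit_disk])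
      show "(\<lambda>z. deriv G z - c * deriv F z) holomorphic_on unit_disk" by (intro holomorphic_on_diff holomorphic_on_mult holomorphic_on_const dF dG)
      show "z0 islimpt ball z0 e" using e(1) by (simp add: islimpt_ball)
      show "deriv G z - c * deriv F z = 0" if "z \<in> ball z0 e" for z using Gc[OF that] by simp
    qed (use sub z0 in simp_all)
    then have "cmod (deriv G 0) = cmod (deriv F 0)" using \<open>cmod c = 1\<close> by (simp add: norm_mult)
    with ne show False by simp
  qed
qed

section \<open>Boundedness of the front and assembly\<close>

text \<open>Normalised at the origin, the primitive grows by at most \<open>B\<close> per unit
  length, and radii are shorter than 1. Adding linear terms to \<open>F\<close> and \<open>G\<close>
  brings such primitives into the new \<open>K\<close>.\<close>

lemma bounded_primitive:
  assumes f: "f holomorphic_on unit_disk" and B: "\<And>z. z \<in> unit_disk \<Longrightarrow> cmod (f z) \<le> B"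
  obtains g where "\<And>z. z \<in> unit_disk \<Longrightarrow> (g has_field_derivative f z) (at z)"
    "\<And>z. z \<in> unit_disk \<Longrightarrow> cmod (g z) \<le> B"
proof -
  obtain h where h: "\<And>z. z \<in> unit_disk \<Longrightarrow> (h has_field_derivative f z) (at z within unit_disk)"
    using holomorphic_convex_primitive'[OF convex_ball open_ball f] by blast
  show ?thesis
  proof (rule that[of "\<lambda>z. h z - h 0"])
    fix z assume z: "z \<in> unit_disk"
    have "(h has_field_derivative f z) (at z)" using h[OF z] at_within_open[OF z open_ball] by simp
    then show "((\<lambda>z. h z - h 0) has_field_derivative f z) (at z)" by (auto intro!: derivative_eq_intros)
    have "cmod (h z - h 0) \<le> B * cmod (z - 0)"
      by (rule field_differentiable_bound[OF convex_ball h B z]) simp_all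
    also have "\<dots> \<le> B * 1"
      using z order_trans[OF norm_ge_zero B[OF z]] by (intro mult_left_mono) simp_all
    finally show "cmod (h z - h 0) \<le> B" by simp
  qed
qed

text \<open>With \<open>K' = (F G' - G F') / 2\<close>, the function \<open>K + F G / 2\<close> is a primitive of \<open>F G'\<close>, and the
  vertical coordinate of the front becomes \<open>(|G|\<^sup>2 - |F|\<^sup>2) / 2 - 2 Re K\<close>.\<close>

lemma bounded_front:
  assumes F: "F holomorphic_on unit_disk" and G: "G holomorphic_on unit_disk" and pd: "dtau2_pos_def F G"
    and K: "\<And>z. z \<in> unit_disk \<Longrightarrow> (K has_field_derivative (F z * deriv G z - G z * deriv F z) / 2) (at z)"
    and B: "\<And>z. z \<in> unit_disk \<Longrightarrow> cmod (F z) \<le> B" "\<And>z. z \<in> unit_disk \<Longrightarrow> cmod (G z) \<le> B"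
      "\<And>z. z \<in> unit_disk \<Longrightarrow> cmod (K z) \<le> B"
  shows "\<exists>f. improper_affine_front F G f \<and> bounded (f ` unit_disk)"
proof -
  define f where "f z = (G z + cnj (F z), ((cmod (G z))\<^sup>2 - (cmod (F z))\<^sup>2) / 2 - 2 * Re (K z))" for z
  define H where "H z = K z + F z * G z / 2" for z
  have "(H has_field_derivative F z * deriv G z) (at z)" if z: "z \<in> unit_disk" for z
  proof -
    have dF: "(F has_field_derivative deriv F z) (at z)" by (rule holomorphic_derivI[OF F open_ball z])
    have dG: "(G has_field_derivative deriv G z) (at z)" by (rule holomorphic_derivI[OF G open_ball z])
    show ?thesis unfolding H_def
      by (rule DERIV_cong[OF DERIV_add[OF K[OF z] DERIV_cdivide[OF DERIV_mult[OF dF dG]]]]) (simp add: field_simps)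
  qed
  then have "improper_affine_front F G f"
    unfolding improper_affine_front_def using F G pd
    by (intro conjI exI[of _ H]) (simp_all add: f_def H_def field_simps)
  moreover have "bounded (f ` unit_disk)"
    unfolding bounded_iff
  proof (intro exI ballI)
    fix y assume "y \<in> f ` unit_disk"
    then obtain z where z: "z \<in> unit_disk" and y: "y = f z" by blast
    have 1: "cmod (G z + cnj (F z)) \<le> B + B"
      using norm_triangle_ineq[of "G z" "cnj (F z)"] B[OF z] by simp
    have half: "\<bar>(p - q) / 2\<bar> \<le> r" if "p \<le> r" "q \<le> r" "0 \<le> p" "0 \<le> q" for p q r :: real
      using that by (simp add: abs_le_iff)
    have "\<bar>((cmod (G z))\<^sup>2 - (cmod (F z))\<^sup>2) / 2\<bar> \<le> B\<^sup>2"
      using B[OF z] by (intro half power_mono) simp_all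
    moreover have "\<bar>2 * Re (K z)\<bar> \<le> 2 * B" using abs_Re_le_cmod[of "K z"] B(3)[OF z] by linarith
    ultimately have 2: "\<bar>((cmod (G z))\<^sup>2 - (cmod (F z))\<^sup>2) / 2 - 2 * Re (K z)\<bar> \<le> B\<^sup>2 + 2 * B" by linarith
    show "norm y \<le> (B + B) + (B\<^sup>2 + 2 * B)"
      unfolding y f_def by (rule order_trans[OF norm_Pair_le]) (use 1 2 in \<open>simp add: add_mono\<close>)
  qed
  ultimately show ?thesis by blast
qed

theorem theorem4p3:
  "\<exists>(f :: complex \<Rightarrow> complex \<times> real) F G.
     improper_affine_front F G f \<and>
     weakly_complete F G \<and>
     bounded (f ` unit_disk) \<and>
     open (unit_disk - singular_set F G) \<and>
     unit_disk \<subseteq> closure (unit_disk - singular_set F G)"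
proof -
  obtain F G K :: "complex \<Rightarrow> complex" and a b m :: "nat \<Rightarrow> real" where
    F: "F holomorphic_on unit_disk" and G: "G holomorphic_on unit_disk" and K: "K holomorphic_on unit_disk"
    and K': "\<And>z. z \<in> unit_disk \<Longrightarrow> deriv K z = (F z * deriv G z - G z * deriv F z) / 2"
    and FB: "\<And>z. z \<in> unit_disk \<Longrightarrow> cmod (F z) \<le> 3" and GB: "\<And>z. z \<in> unit_disk \<Longrightarrow> cmod (G z) \<le> 3"
    and KB: "\<And>z. z \<in> unit_disk \<Longrightarrow> cmod (K z) \<le> 2"
    and ab: "\<And>n. 0 < a n" "\<And>n. a n < b n" "\<And>n. b n < a (Suc n)" "\<And>n. b n < 1" and a1: "a \<longlonglongrightarrow> 1"
    and m: "\<And>n. real n \<le> m n" "\<And>n. m n * (b n - a n) = 1 / (32000 * (real n + 2))"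
    and low: "\<And>n z. a n \<le> cmod z \<Longrightarrow> cmod z \<le> b n \<Longrightarrow> m n - 1 \<le> norm (deriv F z, deriv G z)"
    using bounded_contact_disk by metis
  have dF: "(F has_field_derivative deriv F z) (at z)" and dG: "(G has_field_derivative deriv G z) (at z)"
    and dK: "(K has_field_derivative deriv K z) (at z)" if z: "z \<in> unit_disk" for z
    by (rule holomorphic_derivI[OF F open_ball z] holomorphic_derivI[OF G open_ball z] holomorphic_derivI[OF K open_ball z])+
  obtain \<alpha> \<beta> where zero: "cmod (deriv F 0 + \<alpha>) < cmod (deriv G 0 + \<beta>)"
    and nz: "\<And>z. z \<in> unit_disk \<Longrightarrow> deriv F z + \<alpha> \<noteq> 0 \<or> deriv G z + \<beta> \<noteq> 0"
    using common_zero_avoidance[OF holomorphic_deriv[OF F open_ball] holomorphic_deriv[OF G open_ball]] by metis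
  obtain f where f: "\<And>z. z \<in> unit_disk \<Longrightarrow> (f has_field_derivative F z) (at z)" "\<And>z. z \<in> unit_disk \<Longrightarrow> cmod (f z) \<le> 3"
    using bounded_primitive[OF F FB] by metis
  obtain g where g: "\<And>z. z \<in> unit_disk \<Longrightarrow> (g has_field_derivative G z) (at z)" "\<And>z. z \<in> unit_disk \<Longrightarrow> cmod (g z) \<le> 3"
    using bounded_primitive[OF G GB] by metis
  define F1 where "F1 z = F z + \<alpha> * z" for z
  define G1 where "G1 z = G z + \<beta> * z" for z
  \<comment> \<open>The linear terms add \<open>\<alpha>\<close> (z G' - G) / 2 +
    \<open>\<beta>\<close> (F - z F') / 2 to the derivative of \<open>K\<close>; their
    \<open>\<alpha>\<close> \<open>\<beta>\<close> contributions cancel. Integration by parts gives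
    a primitive in which only \<open>F\<close>, \<open>G\<close> and their primitives occur, so it
    stays bounded.\<close>
  define K1 where "K1 z = K z + \<alpha> * (z * G z / 2 - g z) + \<beta> * (f z - z * F z / 2)" for z
  have dF1: "(F1 has_field_derivative deriv F z + \<alpha>) (at z)" if z: "z \<in> unit_disk" for z
    unfolding F1_def by (rule DERIV_cong[OF DERIV_add[OF dF[OF z] DERIV_cmult[OF DERIV_ident]]]) simp
  have dG1: "(G1 has_field_derivative deriv G z + \<beta>) (at z)" if z: "z \<in> unit_disk" for z
    unfolding G1_def by (rule DERIV_cong[OF DERIV_add[OF dG[OF z] DERIV_cmult[OF DERIV_ident]]]) simp
  have derF1: "deriv F1 z = deriv F z + \<alpha>" and derG1: "deriv G1 z = deriv G z + \<beta>" if z: "z \<in> unit_disk" for z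
    by (rule DERIV_imp_deriv dF1[OF z] dG1[OF z])+
  have hF1: "F1 holomorphic_on unit_disk" unfolding F1_def by (intro holomorphic_intros F)
  have hG1: "G1 holomorphic_on unit_disk" unfolding G1_def by (intro holomorphic_intros G)
  have nz1: "deriv F1 z \<noteq> 0 \<or> deriv G1 z \<noteq> 0" if z: "z \<in> unit_disk" for z
    using nz[OF z] by (simp add: derF1[OF z] derG1[OF z])
  have pd: "dtau2_pos_def F1 G1"
    unfolding dtau2_pos_def_def dtau2_def
  proof (intro ballI allI impI)
    fix z v :: complex assume "z \<in> unit_disk" "v \<noteq> 0"
    then show "0 < (cmod (deriv F1 z * v))\<^sup>2 + (cmod (deriv G1 z * v))\<^sup>2"
      using nz1[of z] by (auto simp: sum_power2_gt_zero_iff)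
  qed
  have dK1: "(K1 has_field_derivative (F1 z * deriv G1 z - G1 z * deriv F1 z) / 2) (at z)" if z: "z \<in> unit_disk" for z
    unfolding K1_def derF1[OF z] derG1[OF z] F1_def G1_def
    by (rule DERIV_cong[OF DERIV_add[OF DERIV_add[OF dK[OF z]
            DERIV_cmult[OF DERIV_diff[OF DERIV_cdivide[OF DERIV_mult[OF DERIV_ident dG[OF z]]] g(1)[OF z]]]]
            DERIV_cmult[OF DERIV_diff[OF f(1)[OF z] DERIV_cdivide[OF DERIV_mult[OF DERIV_ident dF[OF z]]]]]]])
       (simp add: K'[OF z] field_simps)
  \<comment> \<open>A common bound: both brackets in \<open>K1\<close> are at most 3/2 + 3 <
    5.\<close>
  define B where "B = 3 + 5 * (cmod \<alpha> + cmod \<beta>)"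
  have small: "cmod (c * z) \<le> cmod c" if z: "z \<in> unit_disk" for c z
    using z mult_left_mono[of "cmod z" 1 "cmod c"] by (simp add: norm_mult)
  have FB1: "cmod (F1 z) \<le> B" if z: "z \<in> unit_disk" for z
    using norm_triangle_ineq[of "F z" "\<alpha> * z"] small[OF z, of \<alpha>] FB[OF z] norm_ge_zero[of \<alpha>] norm_ge_zero[of \<beta>]
    unfolding F1_def B_def by argo
  have GB1: "cmod (G1 z) \<le> B" if z: "z \<in> unit_disk" for z
    using norm_triangle_ineq[of "G z" "\<beta> * z"] small[OF z, of \<beta>] GB[OF z] norm_ge_zero[of \<alpha>] norm_ge_zero[of \<beta>]
    unfolding G1_def B_def by argo
  have KB1: "cmod (K1 z) \<le> B" if z: "z \<in> unit_disk" for z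
  proof -
    have "cmod (z * G z / 2 - g z) \<le> 5"
      using norm_triangle_ineq4[of "z * G z / 2" "g z"] small[OF z, of "G z"] GB[OF z] g(2)[OF z]
      by (simp add: norm_divide mult.commute[of z])
    then have 1: "cmod (\<alpha> * (z * G z / 2 - g z)) \<le> cmod \<alpha> * 5" unfolding norm_mult by (rule mult_left_mono) simp
    have "cmod (f z - z * F z / 2) \<le> 5"
      using norm_triangle_ineq4[of "f z" "z * F z / 2"] small[OF z, of "F z"] FB[OF z] f(2)[OF z]
      by (simp add: norm_divide mult.commute[of z])
    then have 2: "cmod (\<beta> * (f z - z * F z / 2)) \<le> cmod \<beta> * 5" unfolding norm_mult by (rule mult_left_mono) simp
    have "cmod (K1 z) \<le> 2 + cmod \<alpha> * 5 + cmod \<beta> * 5"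
      unfolding K1_def by (intro norm_triangle_le add_mono KB[OF z] 1 2 order_trans[OF norm_triangle_ineq])
    then show ?thesis unfolding B_def by simp
  qed
  obtain h where h: "improper_affine_front F1 G1 h" "bounded (h ` unit_disk)"
    using bounded_front[OF hF1 hG1 pd dK1 FB1 GB1 KB1] by blast
  \<comment> \<open>The total loss of speed, 1 from the limit and the rest from the linear terms.
    Since \<open>m\<close> is at least n, dropping the first \<open>k\<close> annuli makes the loss
    at most half of the speed.\<close>
  define c where "c = 1 + norm (\<alpha>, \<beta>)"
  obtain k where k: "2 * c \<le> real k" using real_arch_simple by blast
  have "weakly_complete F1 G1"
  proof (rule weakly_complete_criterion[OF hF1 hG1 pd, where a = "\<lambda>n. a (n + k)" and b = "\<lambda>n. b (n + k)" and m = "\<lambda>n. m (n + k) / 2"])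
    show "(\<lambda>n. a (n + k)) \<longlonglongrightarrow> 1" using a1 by (rule LIMSEQ_ignore_initial_segment)
    show "0 \<le> m (n + k) / 2" for n using m(1)[of "n + k"] by simp
    show "\<not> summable (\<lambda>n. m (n + k) / 2 * (b (n + k) - a (n + k)))"
    proof
      assume "summable (\<lambda>n. m (n + k) / 2 * (b (n + k) - a (n + k)))"
      \<comment> \<open>The factor 64000 = 2 * 32000 undoes the halving and the constant of the
        annuli, which leaves a tail of the harmonic series.\<close>
      then have "summable (\<lambda>n. 64000 * (m (n + k) / 2 * (b (n + k) - a (n + k))))" by (rule summable_mult)
      also have "(\<lambda>n. 64000 * (m (n + k) / 2 * (b (n + k) - a (n + k)))) = (\<lambda>n. inverse (real (n + (k + 2))))"
      proof
        fix n
        have "64000 * (m (n + k) / 2 * (b (n + k) - a (n + k))) = 32000 * (m (n + k) * (b (n + k) - a (n + k)))" by simp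
        also have "\<dots> = inverse (real (n + (k + 2)))" unfolding m(2) by (simp add: divide_simps)
        finally show "64000 * (m (n + k) / 2 * (b (n + k) - a (n + k))) = inverse (real (n + (k + 2)))" .
      qed
      finally have "summable (\<lambda>n. inverse (real n))"
        using summable_iff_shift[of "\<lambda>n. inverse (real n)" "k + 2"] by simp
      then show False using not_summable_harmonic[where 'a = real] by (simp add: inverse_eq_divide)
    qed
    fix n z assume z: "a (n + k) \<le> cmod z" "cmod z \<le> b (n + k)"
    have zd: "z \<in> unit_disk" using z ab(4)[of "n + k"] by simp
    have "norm (deriv F z, deriv G z) - norm (- \<alpha>, - \<beta>) \<le> norm ((deriv F z, deriv G z) - (- \<alpha>, - \<beta>))"
      by (rule norm_triangle_ineq2)
    then have "norm (deriv F z, deriv G z) - norm (\<alpha>, \<beta>) \<le> norm (deriv F1 z, deriv G1 z)"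
      by (simp add: derF1[OF zd] derG1[OF zd] norm_Pair)
    moreover have "2 * c \<le> m (n + k)" using k m(1)[of "n + k"] by simp
    ultimately show "m (n + k) / 2 \<le> norm (deriv F1 z, deriv G1 z)" using low[OF z] unfolding c_def by argo
  qed (use ab in auto)
  moreover have "unit_disk \<subseteq> closure (unit_disk - singular_set F1 G1)"
    by (rule dense_nonsingular[OF hF1 hG1 nz1]) (use zero in \<open>simp_all add: derF1 derG1\<close>)
  moreover have "open (unit_disk - singular_set F1 G1)" by (rule open_nonsingular(2)[OF hF1 hG1 nz1])
  ultimately show ?thesis using h by blast
qed

end
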